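(* For any polytree $G=(V,E)$ with an upstream partition $V=H\cup O$ of its vertices, the observed variable ideal given by the intersection $$\mathcal{I}^{\leq 3}_O(G)=\mathcal{I}^{\leq 3}(G)\cap\mathbb{C}[s_{ij},t_{ijk}:i,j,k\in O]$$ is generated by the $2$-minors of the submatrices of the trek-matrices $A_{i,j}$ with $i,j$ both in $O$, with columns indexed by $k$ and pairs $(l,m)$ where $k,l,m$ are all in $O$.
   Context: A polytree is a finite directed acyclic graph $G=(V,E)$, $V=\{1,\dots,n\}$, whose underlying undirected graph is a tree. A partition $V=H\cup O$ of the vertices (into hidden vertices $H$ and observed vertices $O$) is an upstream partition if there are no edges $o\to h$ in $G$ with $o\in O$ and $h\in H$. $\mathbb{R}^E$ denotes the set of real $V\times V$ matrices $\Lambda=(\lambda_{ij})$ with $\lambda_{ij}=0$ whenever $i\to j\notin E$. $PD(V)$ is the cone of positive definite symmetric matrices in $\mathbb{R}^{V\times V}$ and $\mathrm{Sym}_3(V)$ is the space of symmetric tensors in $\mathbb{R}^{V\times V\times V}$. The third-order moment model $\mathcal{M}^{\leq 3}(G)\subseteq PD(V)\times\mathrm{Sym}_3(V)$ is the set of all pairs $(S,T)$ with $$S=(I-\Lambda)^{-T}\Omega^{(2)}(I-\Lambda)^{-1},\qquad T=\Omega^{(3)}\bullet(I-\Lambda)^{-1}\bullet(I-\Lambda)^{-1}\bullet(I-\Lambda)^{-1},$$ where $\Omega^{(2)}\in PD(V)$ is diagonal, $\Omega^{(3)}\in\mathrm{Sym}_3(V)$ is diagonal, and $\Lambda\in\mathbb{R}^E$;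 the Tucker product is $(\Omega\bullet M\bullet M\bullet M)_{ijk}=\sum_{a,b,c}\Omega_{abc}M_{ai}M_{bj}M_{ck}$. The third-order moment ideal $\mathcal{I}^{\leq 3}(G)\subseteq\mathbb{C}[s_{ij},t_{ijk}\mid 1\le i\le j\le k\le n]$ is the ideal of all polynomials in the entries $S=(s_{ij})$, $T=(t_{ijk})$ that vanish on $\mathcal{M}^{\leq 3}(G)$ (indices of $s$ and $t$ are symmetric). A $k$-trek between $i_1,\dots,i_k\in V$ is an ordered collection $\tau=(P_1,\dots,P_k)$ of directed paths in $G$ (possibly empty, i.e. a single vertex) such that $P_r$ has sink $i_r$ and all $P_r$ share the same source, called the top of $\tau$. It is simple if its top is the only vertex lying on all $k$ paths. In a polytree, if a $k$-trek between $i_1,\dots,i_k$ exists, there is a unique simple one, and $\operatorname{top}(i_1,\dots,i_k)$ denotes its top. Trek-matrix: for vertices $i,j$ of a polytree such that a 2-trek between $i$ and $j$ exists, $$A_{i,j}=\begin{pmatrix}s_{ik_1}&\cdots&s_{ik_r}&t_{i\ell_1m_1}&\cdots&t_{i\ell_qm_q}\\ s_{jk_1}&\cdots&s_{jk_r}&t_{j\ell_1m_1}&\cdots&t_{j\ell_qm_q}\end{pmatrix},$$ where $k_1,\dots,k_r$ are all vertices $k$ such that $\operatorname{top}(i,k)$ and $\operatorname{top}(j,k)$ exist and are equal (column indexed by $k$), and $(\ell_1,m_1),\dots,(\ell_q,m_q)$ are all (unordered, possibly repeated-entry) pairs of vertices $(\ell,m)$ such that $\operatorname{top}(i,\ell,m)$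 and $\operatorname{top}(j,\ell,m)$ exist and are equal (column indexed by $(\ell,m)$).
   Formalization: The generators also include the variables s_ij, t_ijk (indices in O) with no trek between their indices; these vanish on the model, so the claim with 2-minors alone fails, e.g. s_12 for 1→3←2 with H empty. *)

theory Defs
  imports "HOL-Analysis.Analysis" "HOL-Library.Poly_Mapping" "HOL-Algebra.Ideal"
begin

text \<open>
  Throughout, the vertex set \<open>V = {1, \<dots>, n}\<close> is the universe of a finite, linearly ordered
  type \<open>'v\<close>, and a digraph on \<open>V\<close> is its edge relation, with \<open>(i, j) \<in> E\<close> for \<open>i \<rightarrow> j\<close>.
\<close>

section \<open>Polytrees and treks\<close>

definition undirected_adj :: "'v rel \<Rightarrow> 'v \<Rightarrow> 'v \<Rightarrow> bool" where
  "undirected_adj E u v \<longleftrightarrow> (u, v) \<in> E \<or> (v, u) \<in> E"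

definition undirected_cycle :: "'v rel \<Rightarrow> 'v list \<Rightarrow> bool" where
  "undirected_cycle E c \<longleftrightarrow>
     length c \<ge> 3 \<and> distinct c \<and> successively (undirected_adj E) c \<and>
     undirected_adj E (last c) (hd c)"

text \<open>Acyclicity of \<open>E\<close> rules out loops and pairs of opposite edges, so the underlying
  graph is simple and its cycles have length at least three.\<close>

definition polytree :: "'v rel \<Rightarrow> bool" where
  "polytree E \<longleftrightarrow>
     acyclic E \<and> (\<forall>u v. (undirected_adj E)\<^sup>*\<^sup>* u v) \<and> (\<nexists>c. undirected_cycle E c)"

definition upstream_partition :: "'v rel \<Rightarrow> 'v set \<Rightarrow> 'v set \<Rightarrow> bool" where
  "upstream_partition E Hid Obs \<longleftrightarrow>
     Hid \<union> Obs = UNIV \<and> Hid \<inter> Obs = {} \<and> (\<forall>u\<in>Obs. \<forall>h\<in>Hid. (u, h) \<notin> E)"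

definition directed_path :: "'v rel \<Rightarrow> 'v list \<Rightarrow> bool" where
  "directed_path E p \<longleftrightarrow> p \<noteq> [] \<and> successively (\<lambda>u v. (u, v) \<in> E) p"

definition trek :: "'v rel \<Rightarrow> 'v list \<Rightarrow> 'v \<Rightarrow> 'v list list \<Rightarrow> bool" where
  "trek E vs r ps \<longleftrightarrow> list_all2 (\<lambda>v p. directed_path E p \<and> hd p = r \<and> last p = v) vs ps"

definition simple_trek :: "'v rel \<Rightarrow> 'v list \<Rightarrow> 'v \<Rightarrow> 'v list list \<Rightarrow> bool" where
  "simple_trek E vs r ps \<longleftrightarrow> trek E vs r ps \<and> (\<Inter>p\<in>set ps. set p) = {r}"

definition trek_exists :: "'v rel \<Rightarrow> 'v list \<Rightarrow> bool" where
  "trek_exists E vs \<longleftrightarrow> (\<exists>r ps. trek E vs r ps)"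

text \<open>Only meaningful if \<^term>\<open>trek_exists E vs\<close>; every use below is guarded by this.\<close>

definition trek_top :: "'v rel \<Rightarrow> 'v list \<Rightarrow> 'v" where
  "trek_top E vs = (THE r. \<exists>ps. simple_trek E vs r ps)"

definition same_top :: "'v rel \<Rightarrow> 'v list \<Rightarrow> 'v list \<Rightarrow> bool" where
  "same_top E vs ws \<longleftrightarrow>
     trek_exists E vs \<and> trek_exists E ws \<and> trek_top E vs = trek_top E ws"


section \<open>The third-order moment model\<close>

definition edge_matrices :: "'v rel \<Rightarrow> (real^'v^'v) set" where
  "edge_matrices E = {L. \<forall>i j. (i, j) \<notin> E \<longrightarrow> L $ i $ j = 0}"

definition PD :: "(real^'v^'v) set" where
  "PD = {S. transpose S = S \<and> (\<forall>x. x \<noteq> 0 \<longrightarrow> x \<bullet> (S *v x) > 0)}"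

definition Sym3 :: "(real^'v^'v^'v) set" where
  "Sym3 = {T. \<forall>i j k. T $ i $ j $ k = T $ j $ i $ k \<and> T $ i $ j $ k = T $ i $ k $ j}"

definition diagonal2 :: "real^'v^'v \<Rightarrow> bool" where
  "diagonal2 W \<longleftrightarrow> (\<forall>a b. a \<noteq> b \<longrightarrow> W $ a $ b = 0)"

definition diagonal3 :: "real^'v^'v^'v \<Rightarrow> bool" where
  "diagonal3 W \<longleftrightarrow> (\<forall>a b c. \<not> (a = b \<and> b = c) \<longrightarrow> W $ a $ b $ c = 0)"

definition tucker3 ::
  "real^'v^'v^'v \<Rightarrow> real^'v^'v \<Rightarrow> real^'v^'v \<Rightarrow> real^'v^'v \<Rightarrow> real^'v^'v^'v" where
  "tucker3 W L M N =
     (\<chi> i j k. \<Sum>a\<in>UNIV. \<Sum>b\<in>UNIV. \<Sum>c\<in>UNIV. W $ a $ b $ c * L $ a $ i * M $ b $ j * N $ c $ k)"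

definition moment_model :: "'v::finite rel \<Rightarrow> ((real^'v^'v) \<times> (real^'v^'v^'v)) set" where
  "moment_model E =
     {(S, T). \<exists>L W2 W3.
        L \<in> edge_matrices E \<and> W2 \<in> PD \<and> diagonal2 W2 \<and> W3 \<in> Sym3 \<and> diagonal3 W3 \<and>
        S = transpose (matrix_inv (mat 1 - L)) ** W2 ** matrix_inv (mat 1 - L) \<and>
        T = tucker3 W3 (matrix_inv (mat 1 - L)) (matrix_inv (mat 1 - L)) (matrix_inv (mat 1 - L))}"


section \<open>Polynomials in the moments\<close>

text \<open>
  A polynomial maps finitely many monomials to nonzero coefficients, a monomial maps finitely many
  indeterminates to nonzero exponents; multiplication on \<open>\<Rightarrow>\<^sub>0\<close> is convolution.
\<close>

type_synonym 'x cpoly = "('x \<Rightarrow>\<^sub>0 nat) \<Rightarrow>\<^sub>0 complex"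

definition indet :: "'x \<Rightarrow> 'x cpoly" where
  "indet x = Poly_Mapping.single (Poly_Mapping.single x 1) 1"

definition eval_cpoly :: "('x \<Rightarrow> complex) \<Rightarrow> 'x cpoly \<Rightarrow> complex" where
  "eval_cpoly f p =
     (\<Sum>m\<in>Poly_Mapping.keys p.
        Poly_Mapping.lookup p m * (\<Prod>x\<in>Poly_Mapping.keys m. f x ^ Poly_Mapping.lookup m x))"

definition cpoly_ring :: "'x set \<Rightarrow> 'x cpoly ring" where
  "cpoly_ring X =
     \<lparr>carrier = {p. \<forall>m\<in>Poly_Mapping.keys p. Poly_Mapping.keys m \<subseteq> X},
      mult = (*), one = 1, zero = 0, add = (+)\<rparr>"

lemma cring_cpoly_ring: "cring (cpoly_ring X)"
proof -
  have add: "p + q \<in> carrier (cpoly_ring X)"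
    if "p \<in> carrier (cpoly_ring X)" "q \<in> carrier (cpoly_ring X)" for p q
    using that Poly_Mapping.keys_add[of p q] unfolding cpoly_ring_def by auto
  have mult: "p * q \<in> carrier (cpoly_ring X)"
    if p: "p \<in> carrier (cpoly_ring X)" and q: "q \<in> carrier (cpoly_ring X)" for p q
  proof -
    have "Poly_Mapping.keys m \<subseteq> X" if m: "m \<in> Poly_Mapping.keys (p * q)" for m
    proof -
      obtain a b where ab: "m = a + b" "a \<in> Poly_Mapping.keys p" "b \<in> Poly_Mapping.keys q"
        using m Poly_Mapping.keys_mult[of p q] by blast
      have "Poly_Mapping.keys a \<subseteq> X" "Poly_Mapping.keys b \<subseteq> X"
        using p q ab(2,3) by (simp_all add: cpoly_ring_def)
      then show ?thesis
        using ab(1) Poly_Mapping.keys_add[of a b] by blast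
    qed
    then show ?thesis by (simp add: cpoly_ring_def)
  qed
  have one: "1 \<in> carrier (cpoly_ring X)" and zero: "0 \<in> carrier (cpoly_ring X)"
    by (simp_all add: cpoly_ring_def)
  have uminus: "- p \<in> carrier (cpoly_ring X)" if "p \<in> carrier (cpoly_ring X)" for p
    using that by (simp add: cpoly_ring_def)
  have ops: "x \<otimes>\<^bsub>cpoly_ring X\<^esub> y = x * y" "x \<oplus>\<^bsub>cpoly_ring X\<^esub> y = x + y"
    "\<one>\<^bsub>cpoly_ring X\<^esub> = 1" "\<zero>\<^bsub>cpoly_ring X\<^esub> = 0" for x y
    by (simp_all add: cpoly_ring_def)
  show ?thesis
  proof (rule cringI)
    show "abelian_group (cpoly_ring X)"
    proof (rule abelian_groupI; unfold ops)
      show "\<exists>q\<in>carrier (cpoly_ring X). q + p = 0" if "p \<in> carrier (cpoly_ring X)" for p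
        using uminus[OF that] by (intro bexI[of _ "- p"]) simp_all
    qed (simp_all only: add zero add.assoc add_0_left, simp only: add.commute)
    show "Group.comm_monoid (cpoly_ring X)"
      by (rule comm_monoidI; unfold ops)
         (simp_all only: mult one mult.assoc mult_1_left, simp only: mult.commute)
  qed (simp only: ops distrib_right)
qed

text \<open>
  The indeterminates of the moment ring are \<open>S_var i j\<close> with \<open>i \<le> j\<close> and \<open>T_var i j k\<close> with
  \<open>i \<le> j \<le> k\<close>.  The polynomials \<open>s_poly i j\<close> and \<open>t_poly i j k\<close> sort their indices and are thereby
  symmetric in them.
\<close>

datatype 'v moment_var = S_var 'v 'v | T_var 'v 'v 'v

definition s_poly :: "'v::linorder \<Rightarrow> 'v \<Rightarrow> 'v moment_var cpoly" where
  "s_poly i j = (let l = sort [i, j] in indet (S_var (l ! 0) (l ! 1)))"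

definition t_poly :: "'v::linorder \<Rightarrow> 'v \<Rightarrow> 'v \<Rightarrow> 'v moment_var cpoly" where
  "t_poly i j k = (let l = sort [i, j, k] in indet (T_var (l ! 0) (l ! 1) (l ! 2)))"

definition moment_vars :: "'v::linorder set \<Rightarrow> 'v moment_var set" where
  "moment_vars A =
     {S_var i j | i j. i \<in> A \<and> j \<in> A \<and> i \<le> j} \<union>
     {T_var i j k | i j k. i \<in> A \<and> j \<in> A \<and> k \<in> A \<and> i \<le> j \<and> j \<le> k}"

abbreviation moment_ring :: "'v::linorder set \<Rightarrow> 'v moment_var cpoly ring" where
  "moment_ring A \<equiv> cpoly_ring (moment_vars A)"

fun moment_value ::
  "real^'v^'v \<Rightarrow> real^'v^'v^'v \<Rightarrow> 'v moment_var \<Rightarrow> complex" where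
  "moment_value S T (S_var i j) = complex_of_real (S $ i $ j)"
| "moment_value S T (T_var i j k) = complex_of_real (T $ i $ j $ k)"

definition moment_ideal :: "'v::{finite,linorder} rel \<Rightarrow> 'v moment_var cpoly set" where
  "moment_ideal E =
     {p \<in> carrier (moment_ring UNIV).
        \<forall>(S, T) \<in> moment_model E. eval_cpoly (moment_value S T) p = 0}"

definition observed_ideal ::
  "'v::{finite,linorder} rel \<Rightarrow> 'v set \<Rightarrow> 'v moment_var cpoly set" where
  "observed_ideal E Obs = moment_ideal E \<inter> carrier (moment_ring Obs)"


section \<open>Trek-matrices\<close>

text \<open>
  The columns of \<open>A\<^sub>i\<^sub>,\<^sub>j\<close> are labelled by vertices \<open>k\<close> and by unordered pairs \<open>(l, m)\<close>,
  represented with \<open>l \<le> m\<close>.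
\<close>

datatype 'v trek_column = S_col 'v | T_col 'v 'v

definition trek_matrix_columns ::
  "'v::linorder rel \<Rightarrow> 'v \<Rightarrow> 'v \<Rightarrow> 'v trek_column set" where
  "trek_matrix_columns E i j =
     {S_col k | k. same_top E [i, k] [j, k]} \<union>
     {T_col l m | l m. l \<le> m \<and> same_top E [i, l, m] [j, l, m]}"

fun trek_matrix_entry :: "'v::linorder \<Rightarrow> 'v trek_column \<Rightarrow> 'v moment_var cpoly" where
  "trek_matrix_entry i (S_col k) = s_poly i k"
| "trek_matrix_entry i (T_col l m) = t_poly i l m"

definition trek_matrix_minor ::
  "'v::linorder \<Rightarrow> 'v \<Rightarrow> 'v trek_column \<Rightarrow> 'v trek_column \<Rightarrow> 'v moment_var cpoly" where
  "trek_matrix_minor i j c d =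
     trek_matrix_entry i c * trek_matrix_entry j d -
     trek_matrix_entry i d * trek_matrix_entry j c"

definition observed_trek_minors ::
  "'v::linorder rel \<Rightarrow> 'v set \<Rightarrow> 'v moment_var cpoly set" where
  "observed_trek_minors E Obs =
     {trek_matrix_minor i j c d | i j c d.
        i \<in> Obs \<and> j \<in> Obs \<and> trek_exists E [i, j] \<and>
        c \<in> trek_matrix_columns E i j \<and> d \<in> trek_matrix_columns E i j \<and> c \<noteq> d \<and>
        set_trek_column c \<subseteq> Obs \<and> set_trek_column d \<subseteq> Obs}"

text \<open>
  Moments without a trek vanish identically on the model.  Such indeterminates lie in the moment
  ideal but not in any ideal generated by 2-minors (these have degree 2), so
  presentations by 2-minors are modulo these indeterminates.  There are none if every two and every
  three observed vertices are joined by a trek.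
\<close>

definition observed_trekless_moments ::
  "'v::linorder rel \<Rightarrow> 'v set \<Rightarrow> 'v moment_var cpoly set" where
  "observed_trekless_moments E Obs =
     {s_poly i j | i j. i \<in> Obs \<and> j \<in> Obs \<and> \<not> trek_exists E [i, j]} \<union>
     {t_poly i j k | i j k. i \<in> Obs \<and> j \<in> Obs \<and> k \<in> Obs \<and> \<not> trek_exists E [i, j, k]}"

end

theory Submission
  imports Defs
begin

text \<open>
  In a polytree \<open>S\<^sub>i\<^sub>j\<close> and \<open>T\<^sub>i\<^sub>j\<^sub>k\<close> are the monomials ``moment of the top times the edge coefficients
  along the simple trek'', and the moments of the tops are free parameters; so the ideal is toric.
  Read an indeterminate as the multiset of its two or three indices, each index being a token that
  travels from the top down to it. Then a 2-minor of a trek-matrix exchanges two tokens \<open>i\<close>, \<open>j\<close>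
  between two multisets without changing their tops, and two monomials have equal images iff they
  have the same tops and send equally many tokens through every edge. Two such monomials \<open>M\<close>, \<open>N\<close>
  are connected by exchanges, by induction on the degree: let \<open>u\<close> be a lowest top, \<open>x'\<close> in \<open>N\<close> and \<open>x\<close>
  in \<open>M\<close> of the same size with top \<open>u\<close>, and make \<open>x\<close> agree with \<open>x'\<close> vertex by vertex, going down
  from \<open>u\<close>. Below \<open>u\<close> every token may be exchanged. At \<open>u\<close> an exchange is forbidden only if it would
  send all tokens of a multiset to the same child; if all direct exchanges are forbidden, a count of
  the tokens sent to that child yields a third multiset that can take over one of them.
\<close>

section \<open>Tops in polytrees\<close>

text \<open>The count that yields the third multiset: a multiset with top \<open>u\<close> can send
  at most all but one of its tokens to a given child of \<open>u\<close>, any other multiset at most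
  all tokens that pass \<open>u\<close>. The sum of these capacities depends only on the tops and on
  the token counts, so it is the same for \<open>M\<close> and \<open>N\<close>; hence if
  \<open>x\<close> sends more tokens to a child than \<open>x'\<close> does, some other multiset of
  \<open>M\<close> stays below its capacity. The obstacle on the analytic side is positivity. The
  moments of the tops are free coordinates only as long as the error variances, recovered from them
  by subtracting what the parents contribute, come out positive. A curve inside the model is enough:
  moments of tops and edge coefficients are powers of one small number \<open>X\<close>. Exponents
  that are powers of a large base separate the finitely many monomials of a given polynomial, and
  giving no edge a smaller exponent than a top keeps the variances positive. An exchange introduces
  no new index, so a chain of exchanges that starts at an observed monomial stays observed, and the
  observed ideal is treated directly, without elimination.\<close>

lemma successively_distinct_shortcut:
  assumes "successively R p" "p \<noteq> []"
  shows "\<exists>q. successively R q \<and> q \<noteq> [] \<and> distinct q \<and> hd q = hd p \<and> last q = last p"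
  using assms
proof (induction "length p" arbitrary: p rule: less_induct)
  case less
  show ?case
  proof (cases "distinct p")
    case False
    then obtain xs ys zs y where p: "p = xs @ [y] @ ys @ [y] @ zs"
      using not_distinct_decomp by blast
    have "successively R (xs @ [y] @ zs)"
      using less.prems(1) unfolding p by (auto simp: successively_append_iff successively_Cons)
    moreover have "hd (xs @ [y] @ zs) = hd p" unfolding p by (cases xs) auto
    moreover have "last (xs @ [y] @ zs) = last p" unfolding p by (cases zs) auto
    ultimately show ?thesis using less.hyps[of "xs @ [y] @ zs"] unfolding p by auto
  qed (use less in blast)
qed

lemma rtranclp_distinct_list:
  assumes "R\<^sup>*\<^sup>* x y"
  shows "\<exists>p. successively R p \<and> p \<noteq> [] \<and> distinct p \<and> hd p = x \<and> last p = y"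
proof -
  have "\<exists>p. successively R p \<and> p \<noteq> [] \<and> hd p = x \<and> last p = y"
    using assms
  proof induction
    case base
    show ?case by (rule exI[of _ "[x]"]) simp
  next
    case (step y z)
    then obtain p where "successively R p" "p \<noteq> []" "hd p = x" "last p = y" by blast
    then show ?case using step(2) by (intro exI[of _ "p @ [z]"]) (auto simp: successively_append_iff)
  qed
  then show ?thesis using successively_distinct_shortcut by metis
qed

locale polytree_graph =
  fixes E :: "'v::finite rel"
  assumes polytree: "polytree E"
begin

lemma acyclic: "acyclic E"
  using polytree unfolding polytree_def by blast

text \<open>A walk around the removed edge, shortened to a path, would close up with that edge to an
  undirected cycle. The uniqueness of parents, children and tops below is reduced to this by
  exhibiting such a walk.\<close>

lemma edge_is_bridge:
  assumes e: "(v, w) \<in> E"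
  shows "\<not> (undirected_adj (E - {(v, w)}))\<^sup>*\<^sup>* w v"
proof
  let ?R = "undirected_adj (E - {(v, w)})"
  assume "?R\<^sup>*\<^sup>* w v"
  then obtain p where p: "successively ?R p" "p \<noteq> []" "distinct p" "hd p = w" "last p = v"
    using rtranclp_distinct_list by metis
  have adj: "undirected_adj E x y" if "?R x y" for x y
    using that unfolding undirected_adj_def by auto
  have vw: "v \<noteq> w" using e acyclic by (auto simp: acyclic_def)
  have wv: "(w, v) \<notin> E"
    using e acyclic by (meson acyclic_def trancl.simps)
  \<comment> \<open>The path \<open>[w]\<close> would make the edge a loop. The path
    \<open>[w, v]\<close> would need the opposite edge, since \<open>(v, w)\<close> itself has been
    removed.\<close>
  have "length p \<ge> 3"
  proof (rule ccontr)
    assume "\<not> length p \<ge> 3"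
    then consider "p = [w]" "w = v" | "p = [w, v]"
      using p(2,4,5) by (cases p; cases "tl p"; cases "tl (tl p)") auto
    then show False
    proof cases
      case 2
      then show ?thesis using p(1) wv by (auto simp: undirected_adj_def)
    qed (use vw in auto)
  qed
  moreover have "successively (undirected_adj E) p"
    using p(1) adj by (rule successively_mono)
  moreover have "undirected_adj E (last p) (hd p)"
    using e p(4,5) by (simp add: undirected_adj_def)
  ultimately have "undirected_cycle E p"
    using p(3) unfolding undirected_cycle_def by blast
  then show False using polytree unfolding polytree_def by blast
qed

definition reaches :: "'v \<Rightarrow> 'v \<Rightarrow> bool" (infix "\<preceq>" 50) where
  "x \<preceq> y \<longleftrightarrow> (x, y) \<in> E\<^sup>*"

lemma reaches_refl [simp]: "x \<preceq> x"
  by (simp add: reaches_def)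

lemma reaches_trans [trans]: "x \<preceq> y \<Longrightarrow> y \<preceq> z \<Longrightarrow> x \<preceq> z"
  by (simp add: reaches_def)

lemma reaches_antisym: "x \<preceq> y \<Longrightarrow> y \<preceq> x \<Longrightarrow> x = y"
  using acyclic unfolding reaches_def
  by (metis acyclic_impl_antisym_rtrancl antisymD)

lemma edge_reaches: "(x, y) \<in> E \<Longrightarrow> x \<preceq> y"
  by (simp add: reaches_def)

lemma edge_not_reaches: "(x, y) \<in> E \<Longrightarrow> \<not> y \<preceq> x"
  using acyclic unfolding reaches_def acyclic_def
  by (meson rtrancl_into_trancl2)

lemma reaches_first: "x \<preceq> y \<Longrightarrow> x \<noteq> y \<Longrightarrow> \<exists>c. (x, c) \<in> E \<and> c \<preceq> y"
  unfolding reaches_def by (meson converse_rtranclE)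

lemma reaches_last: "x \<preceq> y \<Longrightarrow> x \<noteq> y \<Longrightarrow> \<exists>p. x \<preceq> p \<and> (p, y) \<in> E"
  unfolding reaches_def by (meson rtranclE)

text \<open>A directed path from \<open>x\<close> to \<open>y\<close> that uses the edge from
  \<open>v\<close> to \<open>w\<close> shows \<open>x \<preceq> v\<close> and
  \<open>w \<preceq> y\<close>; if one of these fails, the path survives the removal of the
  edge.\<close>

lemma reaches_avoiding:
  assumes "x \<preceq> y" and "\<not> (x \<preceq> v \<and> w \<preceq> y)"
  shows "(undirected_adj (E - {(v, w)}))\<^sup>*\<^sup>* x y" "(undirected_adj (E - {(v, w)}))\<^sup>*\<^sup>* y x"
proof -
  let ?R = "undirected_adj (E - {(v, w)})"
  show *: "?R\<^sup>*\<^sup>* x y"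
    using assms(1)[unfolded reaches_def] assms(2)
  proof (induction rule: rtrancl_induct)
    case (step y z)
    have "\<not> (x \<preceq> v \<and> w \<preceq> y)"
      using step(2,4) edge_reaches reaches_trans by blast
    moreover have "(y, z) \<noteq> (v, w)"
      using step(1,4) by (auto simp: reaches_def)
    ultimately show ?case using step(2,3) by (auto simp: undirected_adj_def intro: rtranclp.rtrancl_into_rtrancl)
  qed simp
  have "symp ?R\<^sup>*\<^sup>*"
    by (rule symp_rtranclp) (auto simp: symp_def undirected_adj_def)
  then show "?R\<^sup>*\<^sup>* y x" using * by (simp add: symp_def)
qed

text \<open>Otherwise \<open>i\<close>, \<open>q\<close>, \<open>u\<close>, \<open>p\<close> are
  stations of a walk around the edge from \<open>p\<close> to \<open>i\<close>.\<close>

lemma unique_parent: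
  assumes "(p, i) \<in> E" "(q, i) \<in> E" "u \<preceq> p" "u \<preceq> q"
  shows "p = q"
proof (rule ccontr)
  assume "p \<noteq> q"
  let ?R = "undirected_adj (E - {(p, i)})"
  have "?R i q" using assms \<open>p \<noteq> q\<close> by (auto simp: undirected_adj_def)
  moreover have "?R\<^sup>*\<^sup>* q u"
    using assms edge_not_reaches by (intro reaches_avoiding) auto
  moreover have "?R\<^sup>*\<^sup>* u p"
    using assms edge_not_reaches by (intro reaches_avoiding) auto
  ultimately have "?R\<^sup>*\<^sup>* i p" by (meson converse_rtranclp_into_rtranclp rtranclp_trans)
  then show False using edge_is_bridge[OF assms(1)] by blast
qed

text \<open>Otherwise \<open>c\<close>, \<open>i\<close>, \<open>d\<close>, \<open>v\<close> are
  stations of a walk around the edge from \<open>v\<close> to \<open>c\<close>.\<close>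

lemma unique_child:
  assumes "(v, c) \<in> E" "(v, d) \<in> E" "c \<preceq> i" "d \<preceq> i"
  shows "c = d"
proof (rule ccontr)
  assume "c \<noteq> d"
  let ?R = "undirected_adj (E - {(v, c)})"
  have "?R d v" using assms \<open>c \<noteq> d\<close> by (auto simp: undirected_adj_def)
  moreover have "?R\<^sup>*\<^sup>* c i"
    using assms edge_not_reaches by (intro reaches_avoiding) auto
  moreover have "?R\<^sup>*\<^sup>* i d"
    using assms edge_not_reaches by (intro reaches_avoiding) auto
  ultimately have "?R\<^sup>*\<^sup>* c v" by (meson rtranclp.rtrancl_into_rtrancl rtranclp_trans)
  then show False using edge_is_bridge[OF assms(1)] by blast
qed

lemma wf_edges: "wf E" "wf (E\<inverse>)"
  using finite_acyclic_wf[OF finite acyclic] finite_acyclic_wf_converse[OF finite acyclic] by auto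

text \<open>As long as \<open>u\<close> differs from \<open>v\<close> and \<open>z\<close>, the
  first edges towards them both lead on to \<open>i\<close>, so they coincide and \<open>u\<close>
  can be moved down.\<close>

lemma reaches_linear:
  assumes "u \<preceq> v" "v \<preceq> i" "u \<preceq> z" "z \<preceq> i"
  shows "v \<preceq> z \<or> z \<preceq> v"
  using assms
proof (induction u rule: wf_induct_rule[OF wf_edges(2)])
  case (1 u)
  show ?case
  proof (cases "u = v \<or> u = z")
    case False
    then obtain c d where "(u, c) \<in> E" "c \<preceq> v" "(u, d) \<in> E" "d \<preceq> z"
      using 1 reaches_first by metis
    moreover from this have "c = d" using 1 unique_child reaches_trans by metis
    ultimately show ?thesis using 1 by blast
  qed (use 1 in auto)
qed

section \<open>Tops of simple treks as lowest common ancestors\<close>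

definition common_ancestor :: "'v set \<Rightarrow> 'v \<Rightarrow> bool" where
  "common_ancestor A r \<longleftrightarrow> (\<forall>i\<in>A. r \<preceq> i)"

text \<open>A description of the top by the reachability order alone;
  \<open>simple_trek_iff_is_top\<close> links it to treks, after which no paths are needed.\<close>

definition is_top :: "'v set \<Rightarrow> 'v \<Rightarrow> bool" where
  "is_top A r \<longleftrightarrow> common_ancestor A r \<and> (\<forall>q. common_ancestor A q \<longrightarrow> q \<preceq> r)"

lemma is_top_unique: "is_top A r \<Longrightarrow> is_top A q \<Longrightarrow> r = q"
  unfolding is_top_def using reaches_antisym by blast

text \<open>In a polytree a locally lowest common ancestor is the lowest one. If \<open>r\<close> is
  not in \<open>A\<close>, maximality provides different children \<open>c\<close> and
  \<open>d\<close> of \<open>r\<close> leading to elements \<open>i\<close> and \<open>j\<close> of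
  \<open>A\<close>; a common ancestor \<open>q\<close> not above \<open>r\<close> would give the
  walk \<open>c\<close>, \<open>i\<close>, \<open>q\<close>, \<open>j\<close>, \<open>d\<close>,
  \<open>r\<close> around the edge from \<open>r\<close> to \<open>c\<close>.\<close>

lemma maximal_common_ancestor_is_top:
  assumes A: "A \<noteq> {}" and r: "common_ancestor A r"
    and max: "\<And>c. (r, c) \<in> E \<Longrightarrow> \<not> common_ancestor A c"
  shows "is_top A r"
  unfolding is_top_def
proof (intro conjI allI impI r)
  fix q assume q: "common_ancestor A q"
  show "q \<preceq> r"
  proof (cases "r \<in> A")
    case False
    obtain i where i: "i \<in> A" using A by blast
    then obtain c where c: "(r, c) \<in> E" "c \<preceq> i"
      using r False reaches_first unfolding common_ancestor_def by metis
    then obtain j where j: "j \<in> A" "\<not> c \<preceq> j"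
      using max unfolding common_ancestor_def by blast
    then obtain d where d: "(r, d) \<in> E" "d \<preceq> j"
      using r False reaches_first unfolding common_ancestor_def by metis
    have cd: "c \<noteq> d" using d j by blast
    show ?thesis
    proof (rule ccontr)
      assume n: "\<not> q \<preceq> r"
      let ?R = "undirected_adj (E - {(r, c)})"
      have "?R\<^sup>*\<^sup>* c i" using c edge_not_reaches by (intro reaches_avoiding) auto
      moreover have "?R\<^sup>*\<^sup>* i q" using q i n by (intro reaches_avoiding) (auto simp: common_ancestor_def)
      moreover have "?R\<^sup>*\<^sup>* q j" using q j n by (intro reaches_avoiding) (auto simp: common_ancestor_def)
      moreover have "?R\<^sup>*\<^sup>* j d" using d edge_not_reaches by (intro reaches_avoiding) auto
      moreover have "?R d r" using d cd by (auto simp: undirected_adj_def)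
      ultimately have "?R\<^sup>*\<^sup>* c r" by (meson rtranclp.rtrancl_into_rtrancl rtranclp_trans)
      then show False using edge_is_bridge[OF c(1)] by blast
    qed
  qed (use q in \<open>auto simp: common_ancestor_def\<close>)
qed

lemma top_exists:
  assumes A: "A \<noteq> {}" and r: "common_ancestor A r"
  shows "\<exists>u. is_top A u"
  using r
proof (induction r rule: wf_induct_rule[OF wf_edges(2)])
  case (1 r)
  then show ?case using maximal_common_ancestor_is_top[OF A] by blast
qed

lemma directed_path_reaches:
  assumes "directed_path E p" "y \<in> set p"
  shows "hd p \<preceq> y" "y \<preceq> last p"
proof -
  have "hd p \<preceq> y \<and> y \<preceq> last p"
    using assms unfolding directed_path_def
  proof (induction p arbitrary: y)
    case (Cons a p)
    show ?case
    proof (cases "p = []")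
      case False
      then obtain b q where p: "p = b # q" by (cases p) auto
      then have ab: "(a, b) \<in> E" using Cons by auto
      have 1: "b \<preceq> x \<and> x \<preceq> last p" if "x \<in> set p" for x
        using Cons.IH[OF _ that] Cons.prems False p by auto
      have "b \<in> set p" using p by simp
      then have "a \<preceq> last p" using 1[of b] ab edge_reaches reaches_trans by blast
      moreover have "y = a \<or> a \<preceq> y \<and> y \<preceq> last p"
        using 1[of y] Cons.prems(1) reaches_trans[OF edge_reaches[OF ab]] Cons.prems(2) by auto
      ultimately show ?thesis using False by auto
    qed (use Cons in auto)
  qed simp
  then show "hd p \<preceq> y" "y \<preceq> last p" by auto
qed

text \<open>At each vertex of the path only one child leads on to the end, so the path has to take
  the edge towards \<open>x\<close>.\<close>

lemma directed_path_between:
  assumes "directed_path E p" "hd p \<preceq> x" "x \<preceq> last p"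
  shows "x \<in> set p"
  using assms unfolding directed_path_def
proof (induction p)
  case (Cons a p)
  show ?case
  proof (cases "p = []")
    case False
    then obtain b q where p: "p = b # q" by (cases p) auto
    then have ab: "(a, b) \<in> E" and dp: "directed_path E p"
      using Cons by (auto simp: directed_path_def)
    show ?thesis
    proof (cases "x = a")
      case n: False
      then obtain c where c: "(a, c) \<in> E" "c \<preceq> x" using Cons reaches_first by force
      have "b \<preceq> last p" using directed_path_reaches[OF dp, of b] p by auto
      then have "b = c" using c ab Cons.prems unique_child[of a b c "last p"] False reaches_trans by force
      then show ?thesis using Cons c p False by auto
    qed simp
  qed (use Cons reaches_antisym in force)
qed simp

lemma directed_path_exists:
  assumes "x \<preceq> y" shows "\<exists>p. directed_path E p \<and> hd p = x \<and> last p = y"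
proof -
  have "(\<lambda>u v. (u, v) \<in> E)\<^sup>*\<^sup>* x y"
    using assms by (simp add: reaches_def rtranclp_rtrancl_eq)
  from rtranclp_distinct_list[OF this] show ?thesis unfolding directed_path_def by blast
qed

lemma trek_common_ancestor:
  assumes "trek E vs r ps" shows "common_ancestor (set vs) r"
  unfolding common_ancestor_def
proof
  fix v assume "v \<in> set vs"
  then obtain p where "directed_path E p" "hd p = r" "last p = v"
    using assms unfolding trek_def by (auto simp: list_all2_conv_all_nth in_set_conv_nth)
  moreover from this have "hd p \<in> set p" by (auto simp: directed_path_def)
  ultimately show "r \<preceq> v" using directed_path_reaches(2) by blast
qed

lemma trek_paths_exist:
  assumes "common_ancestor (set vs) r" shows "\<exists>ps. trek E vs r ps"
proof -
  from assms obtain f where f: "\<And>v. v \<in> set vs \<Longrightarrow> directed_path E (f v) \<and> hd (f v) = r \<and> last (f v) = v"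
    using directed_path_exists unfolding common_ancestor_def by metis
  then have "trek E vs r (map f vs)" unfolding trek_def
    by (auto simp: list_all2_conv_all_nth)
  then show ?thesis by blast
qed

lemma trek_exists_iff: "trek_exists E vs \<longleftrightarrow> (\<exists>r. common_ancestor (set vs) r)"
  unfolding trek_exists_def using trek_common_ancestor trek_paths_exist by blast

lemma trek_Inter_iff:
  assumes "trek E vs r ps" "vs \<noteq> []"
  shows "x \<in> (\<Inter>p\<in>set ps. set p) \<longleftrightarrow> r \<preceq> x \<and> common_ancestor (set vs) x"
proof -
  have len: "length ps = length vs" and nth: "\<And>n. n < length vs \<Longrightarrow>
      directed_path E (ps ! n) \<and> hd (ps ! n) = r \<and> last (ps ! n) = vs ! n"
    using assms unfolding trek_def list_all2_conv_all_nth by auto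
  have 1: "x \<in> set (ps ! n) \<longleftrightarrow> r \<preceq> x \<and> x \<preceq> vs ! n" if "n < length vs" for n
    using nth[OF that] directed_path_reaches directed_path_between by metis
  have "x \<in> (\<Inter>p\<in>set ps. set p) \<longleftrightarrow> (\<forall>n<length vs. x \<in> set (ps ! n))"
    using len by (metis INT_iff in_set_conv_nth)
  also have "\<dots> \<longleftrightarrow> (\<forall>n<length vs. r \<preceq> x \<and> x \<preceq> vs ! n)" using 1 by blast
  also have "\<dots> \<longleftrightarrow> r \<preceq> x \<and> common_ancestor (set vs) x"
    using assms(2) by (force simp: common_ancestor_def in_set_conv_nth)
  finally show ?thesis .
qed

text \<open>By \<open>trek_Inter_iff\<close> the paths of a trek with source \<open>r\<close> share
  exactly the common ancestors below \<open>r\<close>; they share \<open>r\<close> alone iff no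
  child of \<open>r\<close> is a common ancestor.\<close>

lemma simple_trek_iff_is_top:
  assumes "vs \<noteq> []"
  shows "(\<exists>ps. simple_trek E vs r ps) \<longleftrightarrow> is_top (set vs) r"
proof
  assume "\<exists>ps. simple_trek E vs r ps"
  then obtain ps where ps: "trek E vs r ps" "(\<Inter>p\<in>set ps. set p) = {r}"
    unfolding simple_trek_def by blast
  have "\<not> common_ancestor (set vs) c" if "(r, c) \<in> E" for c
  proof
    assume "common_ancestor (set vs) c"
    then have "c = r" using trek_Inter_iff[OF ps(1) assms, of c] ps(2) that edge_reaches by blast
    then show False using that edge_not_reaches by fastforce
  qed
  then show "is_top (set vs) r"
    using maximal_common_ancestor_is_top trek_common_ancestor[OF ps(1)] assms by simp
next
  assume r: "is_top (set vs) r"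
  then obtain ps where ps: "trek E vs r ps" using trek_paths_exist unfolding is_top_def by blast
  have "(\<Inter>p\<in>set ps. set p) = {r}"
    using trek_Inter_iff[OF ps assms] r reaches_antisym unfolding is_top_def by blast
  then show "\<exists>ps. simple_trek E vs r ps" using ps unfolding simple_trek_def by blast
qed

definition top_of :: "'v multiset \<Rightarrow> 'v" where
  "top_of x = (THE r. is_top (set_mset x) r)"

definition linked :: "'v multiset \<Rightarrow> bool" where
  "linked x \<longleftrightarrow> x \<noteq> {#} \<and> (\<exists>r. common_ancestor (set_mset x) r)"

lemma is_top_top_of: "linked x \<Longrightarrow> is_top (set_mset x) (top_of x)"
  unfolding top_of_def linked_def using top_exists is_top_unique
  by (metis set_mset_eq_empty_iff theI)

lemma top_of_eqI: "is_top (set_mset x) r \<Longrightarrow> top_of x = r"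
  unfolding top_of_def using is_top_unique by blast

lemma trek_exists_iff_linked: "vs \<noteq> [] \<Longrightarrow> trek_exists E vs \<longleftrightarrow> linked (mset vs)"
  by (simp add: trek_exists_iff linked_def)

lemma trek_top_eq: "vs \<noteq> [] \<Longrightarrow> trek_top E vs = top_of (mset vs)"
  by (simp add: trek_top_def top_of_def simple_trek_iff_is_top)

lemma same_top_iff:
  assumes "vs \<noteq> []" "ws \<noteq> []"
  shows "same_top E vs ws \<longleftrightarrow> linked (mset vs) \<and> linked (mset ws) \<and> top_of (mset vs) = top_of (mset ws)"
  using assms by (simp add: same_top_def trek_exists_iff_linked trek_top_eq)

lemma top_of_reaches: "linked x \<Longrightarrow> i \<in># x \<Longrightarrow> top_of x \<preceq> i"
  using is_top_top_of unfolding is_top_def common_ancestor_def by blast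

lemma reaches_top_of: "linked x \<Longrightarrow> (\<And>i. i \<in># x \<Longrightarrow> r \<preceq> i) \<Longrightarrow> r \<preceq> top_of x"
  using is_top_top_of unfolding is_top_def common_ancestor_def by blast

lemma linkedI: "x \<noteq> {#} \<Longrightarrow> (\<And>i. i \<in># x \<Longrightarrow> r \<preceq> i) \<Longrightarrow> linked x"
  unfolding linked_def common_ancestor_def by blast

text \<open>A local test that inspects only the children of \<open>u\<close>. Exchanges are checked
  against it.\<close>

lemma top_of_eq_iff:
  assumes "linked x"
  shows "top_of x = u \<longleftrightarrow> (\<forall>i\<in>#x. u \<preceq> i) \<and> (\<forall>c. (u, c) \<in> E \<longrightarrow> (\<exists>i\<in>#x. \<not> c \<preceq> i))"
proof
  assume u: "top_of x = u"
  have "\<exists>i\<in>#x. \<not> c \<preceq> i" if "(u, c) \<in> E" for c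
    using reaches_top_of[OF assms, of c] u edge_not_reaches[OF that] by blast
  then show "(\<forall>i\<in>#x. u \<preceq> i) \<and> (\<forall>c. (u, c) \<in> E \<longrightarrow> (\<exists>i\<in>#x. \<not> c \<preceq> i))"
    using u top_of_reaches[OF assms] by blast
next
  assume "(\<forall>i\<in>#x. u \<preceq> i) \<and> (\<forall>c. (u, c) \<in> E \<longrightarrow> (\<exists>i\<in>#x. \<not> c \<preceq> i))"
  then have "is_top (set_mset x) u"
    using assms by (intro maximal_common_ancestor_is_top) (auto simp: linked_def common_ancestor_def)
  then show "top_of x = u" by (rule top_of_eqI)
qed

end

section \<open>Exchanging tokens\<close>

context polytree_graph begin

text \<open>The next vertex of a token at \<open>v\<close> that travels to \<open>i\<close>.
  Stopping is recorded as a step to \<open>v\<close> itself, so that every token at \<open>v\<close>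
  has exactly one destination.\<close>

definition step :: "'v \<Rightarrow> 'v \<Rightarrow> 'v" where
  "step v i = (if i = v then v else (THE c. (v, c) \<in> E \<and> c \<preceq> i))"

lemma step_self [simp]: "step v v = v"
  by (simp add: step_def)

lemma step_edge:
  assumes "v \<preceq> i" "i \<noteq> v" shows "(v, step v i) \<in> E" "step v i \<preceq> i"
proof -
  obtain c where c: "(v, c) \<in> E" "c \<preceq> i" using assms reaches_first by metis
  then have "(THE c. (v, c) \<in> E \<and> c \<preceq> i) = c"
    using unique_child by blast
  then show "(v, step v i) \<in> E" "step v i \<preceq> i" using c assms by (auto simp: step_def)
qed

lemma step_eqI:
  assumes "(v, c) \<in> E" "c \<preceq> i" shows "step v i = c"
proof -
  have "v \<preceq> i" "i \<noteq> v"
    using assms edge_reaches reaches_trans edge_not_reaches by blast+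
  then show ?thesis using step_edge[of v i] unique_child[OF _ assms(1) _ assms(2)] by blast
qed

lemma step_eq_self_iff: "v \<preceq> i \<Longrightarrow> step v i = v \<longleftrightarrow> i = v"
  using step_edge(1)[of v i] edge_not_reaches by fastforce

lemma step_eq_child_iff:
  assumes "(v, c) \<in> E" shows "v \<preceq> i \<and> step v i = c \<longleftrightarrow> c \<preceq> i"
proof
  assume *: "v \<preceq> i \<and> step v i = c"
  then have "i \<noteq> v" using assms edge_not_reaches[OF assms] by auto
  then show "c \<preceq> i" using * step_edge(2) by blast
next
  assume "c \<preceq> i"
  then show "v \<preceq> i \<and> step v i = c"
    using step_eqI[OF assms] reaches_trans[OF edge_reaches[OF assms]] by blast
qed

text \<open>For an edge this is the exponent of its coefficient in the moment of \<open>x\<close>;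
  for \<open>w = v\<close> it counts the tokens that stop. The guard discards vertices that are
  ancestors of an index but do not lie below the top.\<close>

definition uses :: "'v multiset \<Rightarrow> 'v \<Rightarrow> 'v \<Rightarrow> nat" where
  "uses x v w = (if top_of x \<preceq> v then size {#i \<in># x. v \<preceq> i \<and> step v i = w#} else 0)"

definition passes :: "'v multiset \<Rightarrow> 'v \<Rightarrow> nat" where
  "passes x v = (if top_of x \<preceq> v then size {#i \<in># x. v \<preceq> i#} else 0)"

lemma sum_size_fibres:
  fixes f :: "'a \<Rightarrow> 'b::finite"
  shows "(\<Sum>w\<in>UNIV. size {#i \<in># x. P i \<and> f i = w#}) = size {#i \<in># x. P i#}"
proof (induction x)
  case (add a x)
  have "(\<Sum>w\<in>UNIV. size {#i \<in># add_mset a x. P i \<and> f i = w#}) =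
      (\<Sum>w\<in>UNIV. (if w = f a then (if P a then 1 else 0) else 0) + size {#i \<in># x. P i \<and> f i = w#})"
    by (rule sum.cong) auto
  then show ?case using add by (simp add: sum.distrib)
qed simp

lemma sum_uses: "(\<Sum>w\<in>UNIV. uses x v w) = passes x v"
  unfolding uses_def passes_def using sum_size_fibres[of "\<lambda>i. v \<preceq> i" "step v" x] by auto

lemma uses_le_passes: "uses x v w \<le> passes x v"
  unfolding sum_uses[symmetric] by (rule member_le_sum) auto

lemma passes_top: "linked x \<Longrightarrow> passes x (top_of x) = size x"
  unfolding passes_def using top_of_reaches by (simp add: filter_mset_eq_conv[of _ x x, THEN iffD2])

lemma passes_eq_uses_parent:
  assumes "(p, v) \<in> E" "top_of x \<preceq> p"
  shows "passes x v = uses x p v"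
  using assms(2) reaches_trans[OF assms(2) edge_reaches[OF assms(1)]]
  by (simp add: passes_def uses_def step_eq_child_iff[OF assms(1)])

text \<open>A token at \<open>v\<close> starts there or comes from the one parent of
  \<open>v\<close> below the top; all other parents send nothing because of the guard in
  \<open>uses\<close>.\<close>

lemma passes_conservation:
  assumes "linked x"
  shows "passes x v = (if top_of x = v then size x else 0) + (\<Sum>p\<in>{p. (p, v) \<in> E}. uses x p v)"
proof (cases "top_of x \<preceq> v \<and> top_of x \<noteq> v")
  case True
  then obtain p where p: "top_of x \<preceq> p" "(p, v) \<in> E" using reaches_last by blast
  have "(\<Sum>q\<in>{q. (q, v) \<in> E}. uses x q v) = (\<Sum>q\<in>{p}. uses x q v)"
    using p unique_parent by (intro sum.mono_neutral_right) (auto simp: uses_def)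
  then show ?thesis using True passes_eq_uses_parent[OF p(2,1)] by simp
next
  case False
  have "uses x p v = 0" if "(p, v) \<in> E" for p
  proof -
    have "\<not> top_of x \<preceq> p"
      using False that edge_not_reaches edge_reaches reaches_trans by blast
    then show ?thesis by (simp add: uses_def)
  qed
  then have "(\<Sum>p\<in>{p. (p, v) \<in> E}. uses x p v) = 0" by simp
  moreover have "passes x v = 0" if "top_of x \<noteq> v" using that False by (simp add: passes_def)
  ultimately show ?thesis using passes_top[OF assms] by auto
qed

lemma uses_add_mset:
  assumes "top_of (add_mset i A) \<preceq> v" "v \<preceq> i"
  shows "uses (add_mset i A) v w =
    (if step v i = w then 1 else 0) + size {#i \<in># A. v \<preceq> i \<and> step v i = w#}"
  using assms by (simp add: uses_def)

text \<open>A vertex \<open>z\<close> between \<open>t\<close> and one of the tokens is comparable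
  with \<open>v\<close>, hence lies above it; there both tokens take the step towards
  \<open>v\<close>.\<close>

lemma uses_unaffected:
  assumes "top_of (add_mset i A) = t" "top_of (add_mset j A) = t"
    and "t \<preceq> v" "v \<preceq> i" "v \<preceq> j" "\<not> v \<preceq> z"
  shows "uses (add_mset i A) z w = uses (add_mset j A) z w"
proof -
  have *: "z \<preceq> k \<and> step z k = w \<longleftrightarrow> z \<preceq> v \<and> step z v = w" if k: "v \<preceq> k" and t: "t \<preceq> z" for k
  proof -
    have zv: "z \<preceq> v" if "z \<preceq> k"
      using reaches_linear[OF assms(3) k t that] assms(6) by blast
    have "step z k = step z v" if "z \<preceq> v"
    proof -
      have "z \<noteq> v" using assms(6) by auto
      then show ?thesis
        using step_edge[OF that] step_eqI[of z "step z v" k] reaches_trans[OF _ k] by auto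
    qed
    then show ?thesis using zv reaches_trans[OF _ k] by metis
  qed
  show ?thesis unfolding uses_def using assms *[of i] *[of j] by auto
qed

text \<open>Both \<open>i\<close> and \<open>j\<close> leave \<open>t\<close> through the child that
  leads to \<open>v\<close>, so the exchange cannot turn a child of \<open>t\<close> into a common
  ancestor.\<close>

lemma top_of_exchange_below:
  assumes x: "linked (add_mset i A)" and t: "top_of (add_mset i A) = t"
    and v: "t \<preceq> v" "t \<noteq> v" "v \<preceq> i" "v \<preceq> j"
  shows "linked (add_mset j A) \<and> top_of (add_mset j A) = t"
proof -
  have r: "t \<preceq> k" if "k \<in># add_mset j A" for k
    using that top_of_reaches[OF x] t v reaches_trans by auto
  then have l: "linked (add_mset j A)" by (intro linkedI[of _ t]) auto
  have "\<exists>k\<in>#add_mset j A. \<not> c \<preceq> k" if c: "(t, c) \<in> E" for c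
  proof -
    obtain k where k: "k \<in># add_mset i A" "\<not> c \<preceq> k"
      using top_of_eq_iff[OF x] t c by blast
    have "\<not> c \<preceq> j" if "\<not> c \<preceq> i"
    proof
      assume "c \<preceq> j"
      obtain d where d: "(t, d) \<in> E" "d \<preceq> v" using v reaches_first by metis
      then have "c = d" using c \<open>c \<preceq> j\<close> unique_child v reaches_trans by metis
      then show False using d v that reaches_trans by blast
    qed
    then show ?thesis using k by auto
  qed
  then show ?thesis using l top_of_eq_iff[OF l] r by blast
qed

text \<open>The alternative \<open>j = t\<close> suffices because a token that stops at
  \<open>t\<close> is reached by no child of \<open>t\<close> and thus pins the top.\<close>

lemma top_of_exchange_at:
  assumes x: "linked (add_mset i A)" and t: "top_of (add_mset i A) = t" and j: "t \<preceq> j"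
    and ok: "j = t \<or> (\<exists>q\<in>#A. step t q \<noteq> step t j)"
  shows "linked (add_mset j A) \<and> top_of (add_mset j A) = t"
proof -
  have r: "t \<preceq> k" if "k \<in># add_mset j A" for k
    using that top_of_reaches[OF x] t j by auto
  then have l: "linked (add_mset j A)" by (intro linkedI[of _ t]) auto
  have "\<exists>k\<in>#add_mset j A. \<not> c \<preceq> k" if c: "(t, c) \<in> E" for c
  proof (rule ccontr)
    assume "\<not> ?thesis"
    then have all: "step t k = c \<and> c \<preceq> k" if "k \<in># add_mset j A" for k
      using that c step_eqI by blast
    then have "j \<noteq> t" using c edge_not_reaches by auto
    then show False using ok all by force
  qed
  then show ?thesis using l top_of_eq_iff[OF l] r by blast
qed

lemma exists_step_ne:
  assumes x: "linked x" and w: "w \<noteq> top_of x"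
  shows "\<exists>q\<in>#x. step (top_of x) q \<noteq> w"
proof (cases "(top_of x, w) \<in> E")
  case True
  then obtain q where "q \<in># x" "\<not> w \<preceq> q" using top_of_eq_iff[OF x] by blast
  then show ?thesis using True step_eq_child_iff top_of_reaches[OF x] by blast
next
  case False
  obtain q where "q \<in># x" using x by (auto simp: linked_def)
  then show ?thesis using False w step_edge[of "top_of x" q] top_of_reaches[OF x] by (metis step_self)
qed

lemma uses_top:
  assumes "linked x" shows "uses x (top_of x) w = size {#q \<in># x. step (top_of x) q = w#}"
  using top_of_reaches[OF assms] by (auto simp: uses_def intro!: arg_cong[of _ _ size] filter_mset_cong)

text \<open>If all tokens left for the same child, that child would be a common ancestor. The
  destination \<open>top_of x\<close> is excluded since all tokens may stop at the top, as in a
  variance.\<close>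

lemma uses_top_less:
  assumes x: "linked x" and w: "w \<noteq> top_of x"
  shows "uses x (top_of x) w < size x"
proof -
  obtain q where q: "q \<in># x" "step (top_of x) q \<noteq> w" using exists_step_ne[OF assms] by blast
  then obtain A where "x = add_mset q A" by (metis insert_DiffM)
  then show ?thesis using q uses_top[OF x] size_filter_mset_lesseq[of _ A]
    by (simp add: le_imp_less_Suc)
qed

text \<open>The two terms of a 2-minor in the rows \<open>i\<close>, \<open>j\<close> and the
  columns \<open>A\<close>, \<open>B\<close> of a trek-matrix, times the common factor
  \<open>R\<close>. Both tokens pass \<open>v\<close>, where they may be thought of as trading
  places; this makes the invariance of the token counts visible.\<close>

inductive swap :: "'v multiset multiset \<Rightarrow> 'v multiset multiset \<Rightarrow> bool" where
  swap: "\<lbrakk>linked (add_mset i A); linked (add_mset j B); linked (add_mset j A); linked (add_mset i B);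
    top_of (add_mset j A) = top_of (add_mset i A); top_of (add_mset i B) = top_of (add_mset j B);
    top_of (add_mset i A) \<preceq> v; top_of (add_mset j B) \<preceq> v; v \<preceq> i; v \<preceq> j\<rbrakk>
    \<Longrightarrow> swap (add_mset (add_mset i A) (add_mset (add_mset j B) R))
             (add_mset (add_mset j A) (add_mset (add_mset i B) R))"

definition admissible :: "'v multiset multiset \<Rightarrow> bool" where
  "admissible M \<longleftrightarrow> (\<forall>x\<in>#M. linked x \<and> size x \<ge> 2)"

text \<open>Equality of images under the monomial parametrisation: the first part compares the
  exponents of the moments of tops, the second those of the edge coefficients. Its stopping counts
  \<open>w = v\<close> follow from the rest, see \<open>same_typeI\<close>.\<close>

definition same_type :: "'v multiset multiset \<Rightarrow> 'v multiset multiset \<Rightarrow> bool" where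
  "same_type M N \<longleftrightarrow>
     image_mset (\<lambda>x. (top_of x, size x)) M = image_mset (\<lambda>x. (top_of x, size x)) N \<and>
     (\<forall>v w. (\<Sum>x\<in>#M. uses x v w) = (\<Sum>x\<in>#N. uses x v w))"

lemma swap_admissible: "swap M N \<Longrightarrow> admissible M \<Longrightarrow> admissible N"
  by (induction rule: swap.induct) (auto simp: admissible_def)

text \<open>From \<open>v\<close> downwards both tops lie above \<open>z\<close>, and the sum counts
  the same tokens on either side. Elsewhere \<open>i\<close> and \<open>j\<close> take the same
  steps, so each summand is unchanged by itself.\<close>

lemma uses_exchange:
  assumes "top_of (add_mset j A) = top_of (add_mset i A)" "top_of (add_mset i B) = top_of (add_mset j B)"
    and "top_of (add_mset i A) \<preceq> v" "top_of (add_mset j B) \<preceq> v" "v \<preceq> i" "v \<preceq> j"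
  shows "uses (add_mset i A) z w + uses (add_mset j B) z w =
      uses (add_mset j A) z w + uses (add_mset i B) z w"
proof (cases "v \<preceq> z")
  case True
  then have "top_of (add_mset i A) \<preceq> z" "top_of (add_mset j B) \<preceq> z"
    using assms(3,4) reaches_trans by blast+
  then show ?thesis by (simp add: uses_def assms(1,2))
next
  case False
  show ?thesis
    using uses_unaffected[OF refl assms(1,3,5,6) False] uses_unaffected[OF refl assms(2,4,6,5) False]
    by simp
qed

lemma swap_same_type: "swap M N \<Longrightarrow> same_type M N"
proof (induction rule: swap.induct)
  case (swap i A j B v R)
  note * = uses_exchange[OF swap.hyps(5-10)]
  show ?case unfolding same_type_def
    using swap.hyps(5,6) * by (simp add: add.assoc[symmetric])
qed

lemma same_type_trans: "same_type M N \<Longrightarrow> same_type N K \<Longrightarrow> same_type M K"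
  unfolding same_type_def by auto

lemma same_type_sym: "same_type M N \<Longrightarrow> same_type N M"
  unfolding same_type_def by auto

lemma swaps_admissible: "swap\<^sup>*\<^sup>* M N \<Longrightarrow> admissible M \<Longrightarrow> admissible N"
  by (induction rule: rtranclp_induct) (auto simp: swap_admissible)

lemma swaps_same_type: "swap\<^sup>*\<^sup>* M N \<Longrightarrow> same_type M N"
proof (induction rule: rtranclp_induct)
  case base
  show ?case by (simp add: same_type_def)
next
  case (step N K)
  then show ?case using swap_same_type same_type_trans by blast
qed

lemma swap_add_mset: "swap M N \<Longrightarrow> swap (add_mset x M) (add_mset x N)"
proof (induction rule: swap.induct)
  case (swap i A j B v R)
  show ?case using swap.intros[OF swap, of "add_mset x R"] by (simp add: add_mset_commute)
qed

lemma swaps_add_mset: "swap\<^sup>*\<^sup>* M N \<Longrightarrow> swap\<^sup>*\<^sup>* (add_mset x M) (add_mset x N)"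
proof (induction rule: rtranclp_induct)
  case (step N K)
  then show ?case using swap_add_mset rtranclp.rtrancl_into_rtrancl by metis
qed simp

end

lemma sum_mset_mono_strict_ex:
  fixes f g :: "'a \<Rightarrow> nat"
  assumes "(\<Sum>x\<in>#N. f x) < (\<Sum>x\<in>#N. g x)"
  shows "\<exists>x\<in>#N. f x < g x"
  using assms sum_mset_mono[of N g f] by (meson leD leI)

lemma exists_less_and_greater:
  fixes f g :: "'a::finite \<Rightarrow> nat"
  assumes "(\<Sum>w\<in>UNIV. f w) = (\<Sum>w\<in>UNIV. g w)" "f \<noteq> g"
  shows "\<exists>w w'. f w < g w \<and> g w' < f w'"
proof -
  have *: "\<exists>w. a w < b w" if sums: "(\<Sum>w\<in>UNIV. a w) = (\<Sum>w\<in>UNIV. b w)" and ne: "a \<noteq> b" for a b :: "'a \<Rightarrow> nat"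
  proof (rule ccontr)
    assume "\<nexists>w. a w < b w"
    then have le: "\<And>w. b w \<le> a w" by (simp add: leI)
    obtain w where "a w \<noteq> b w" using ne by blast
    then have "b w < a w" using le[of w] by simp
    then have "(\<Sum>w\<in>UNIV. b w) < (\<Sum>w\<in>UNIV. a w)"
      using le by (intro sum_strict_mono_ex1) auto
    then show False using sums by simp
  qed
  show ?thesis using *[of f g] *[of g f] assms by metis
qed

section \<open>Exchanges that correct a single token of a multiset\<close>

context polytree_graph begin

lemma uses_pos:
  assumes "uses x v w > 0"
  obtains j where "j \<in># x" "top_of x \<preceq> v" "v \<preceq> j" "step v j = w"
proof -
  from assms have t: "top_of x \<preceq> v" and "size {#i \<in># x. v \<preceq> i \<and> step v i = w#} > 0"
    by (auto simp: uses_def split: if_splits)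
  then have "{#i \<in># x. v \<preceq> i \<and> step v i = w#} \<noteq> {#}" by force
  then obtain j where "j \<in># {#i \<in># x. v \<preceq> i \<and> step v i = w#}" by (rule multiset_nonemptyE)
  then show ?thesis using t by (intro that) auto
qed

lemma exchange_top_cases:
  assumes x: "linked (add_mset j B)" and u: "top_of (add_mset j B) \<preceq> u" "u \<preceq> j" "u \<preceq> i"
    and ok: "top_of (add_mset j B) = u \<Longrightarrow> i = u \<or> (\<exists>q\<in>#B. step u q \<noteq> step u i)"
  shows "linked (add_mset i B) \<and> top_of (add_mset i B) = top_of (add_mset j B)"
proof (cases "top_of (add_mset j B) = u")
  case True
  then show ?thesis using top_of_exchange_at[OF x True u(3)] ok by simp
next
  case False
  then show ?thesis using top_of_exchange_below[OF x refl u(1) _ u(2,3)] by blast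
qed

text \<open>Some multiset other than \<open>x\<close> sends a token \<open>j\<close> from
  \<open>v\<close> to \<open>w\<close>, because \<open>x\<close> does not account for all of them.
  As \<open>v\<close> is no top, both tops lie strictly above \<open>v\<close> and survive the
  exchange of \<open>i\<close> and \<open>j\<close>.\<close>

lemma swap_exists_off_top:
  assumes M: "M = add_mset x N" "admissible M"
    and less: "uses x v w < (\<Sum>z\<in>#M. uses z v w)"
    and off: "\<And>z. z \<in># M \<Longrightarrow> top_of z \<noteq> v"
    and i: "x = add_mset i A" "top_of x \<preceq> v" "v \<preceq> i"
  shows "\<exists>j M'. swap M M' \<and> add_mset j A \<in># M' \<and> top_of (add_mset j A) = top_of x \<and> v \<preceq> j \<and> step v j = w"
proof -
  have "0 < (\<Sum>z\<in>#N. uses z v w)" using less M by simp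
  then obtain y where y: "y \<in># N" "uses y v w > 0"
    using sum_mset_mono_strict_ex[of "\<lambda>_. 0" N "\<lambda>z. uses z v w"] by auto
  then obtain j where j: "j \<in># y" "top_of y \<preceq> v" "v \<preceq> j" "step v j = w" by (auto elim: uses_pos)
  obtain B R where B: "y = add_mset j B" "N = add_mset y R" using y(1) j(1) by (metis insert_DiffM)
  have l: "linked x" "linked y" using M B by (auto simp: admissible_def)
  have 1: "linked (add_mset j A) \<and> top_of (add_mset j A) = top_of x"
    using l i j off M by (intro top_of_exchange_below[where v = v and i = i]) auto
  have 2: "linked (add_mset i B) \<and> top_of (add_mset i B) = top_of y"
    using l i j off M B by (intro top_of_exchange_below[where v = v and i = j]) auto
  have "swap M (add_mset (add_mset j A) (add_mset (add_mset i B) R))"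
    unfolding M(1) B(2) i(1) B(1)
    using 1 2 l i j B by (intro swap.intros[where v = v]) auto
  then show ?thesis using 1 j by (intro exI conjI) auto
qed

text \<open>The capacity of \<open>x\<close> at \<open>u\<close>: an upper bound for the tokens that
  it can send to one child. A multiset with top \<open>u\<close> has to keep one token away from
  that child, hence the \<open>- 1\<close>; it is nonempty when admissible, so nothing is
  truncated.\<close>

definition slack :: "'v \<Rightarrow> 'v multiset \<Rightarrow> nat" where
  "slack u x = (if top_of x = u then size x - 1 else passes x u)"

lemma uses_le_slack:
  assumes "linked x" "w \<noteq> u" shows "uses x u w \<le> slack u x"
  using uses_top_less[OF assms(1)] assms(2) uses_le_passes unfolding slack_def by fastforce

lemma sum_slack:
  assumes "admissible M"
  shows "(\<Sum>x\<in>#M. slack u x) + size {#x \<in># M. top_of x = u#} = (\<Sum>x\<in>#M. passes x u)"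
  using assms
proof (induction M)
  case (add x M)
  then have "linked x" "size x \<ge> 2" "admissible M" by (auto simp: admissible_def)
  then show ?case using add.IH passes_top[of x] by (auto simp: slack_def)
qed simp

text \<open>The total capacity is the number of tokens passing \<open>u\<close> minus the number of
  multisets with top \<open>u\<close>, and the type determines both.\<close>

lemma same_type_slack:
  assumes "same_type M N" "admissible M" "admissible N"
  shows "(\<Sum>x\<in>#M. slack u x) = (\<Sum>x\<in>#N. slack u x)"
proof -
  have p: "(\<Sum>x\<in>#K. passes x u) = (\<Sum>w\<in>UNIV. \<Sum>x\<in>#K. uses x u w)" for K
    unfolding sum_uses[symmetric] by (induction K) (auto simp: sum.distrib)
  have q: "size {#x \<in># K. top_of x = u#} =
      size {#t \<in># image_mset (\<lambda>x. (top_of x, size x)) K. fst t = u#}" for K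
    by (induction K) auto
  show ?thesis using sum_slack[OF assms(2), of u] sum_slack[OF assms(3), of u] assms(1)
    unfolding p q same_type_def by simp
qed

text \<open>The conclusion says that \<open>y\<close> can give up \<open>q\<close> for a token
  heading to \<open>w\<close> and keep its top. If no \<open>y\<close> could, the rest of
  \<open>M\<close> would use its full capacity at \<open>w\<close>; the rest of \<open>N'\<close>
  has the same total capacity, and the totals at \<open>w\<close> agree, so \<open>x\<close> could
  not send more tokens to \<open>w\<close> than \<open>x'\<close>.\<close>

lemma exists_receiver:
  assumes M: "M = add_mset x N" and N: "N' = add_mset x' N''"
    and ad: "admissible M" "admissible N'" and st: "same_type M N'"
    and x: "top_of x = u" "top_of x' = u" "size x = size x'"
    and w: "w \<noteq> u" "uses x' u w < uses x u w"
  shows "\<exists>y\<in>#N. \<exists>q\<in>#y. top_of y \<preceq> u \<and> u \<preceq> q \<and> step u q \<noteq> w \<and>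
    (top_of y = u \<longrightarrow> (\<exists>k\<in>#y - {#q#}. step u k \<noteq> w))"
proof (rule ccontr)
  assume neg: "\<not> ?thesis"
  \<comment> \<open>Either all tokens of \<open>y\<close> passing \<open>u\<close> go to
    \<open>w\<close>, or \<open>y\<close> has top \<open>u\<close> and \<open>q\<close> is its only
    token going elsewhere; in both cases the capacity is exhausted.\<close>
  have "slack u y \<le> uses y u w" if y: "y \<in># N" for y
  proof (cases "top_of y \<preceq> u")
    case True
    have l: "linked y" using y ad M by (auto simp: admissible_def)
    show ?thesis
    proof (cases "\<exists>q\<in>#y. u \<preceq> q \<and> step u q \<noteq> w")
      case q: True
      then obtain q where q: "q \<in># y" "u \<preceq> q" "step u q \<noteq> w" by blast
      then have top: "top_of y = u" and all: "\<forall>k\<in>#y - {#q#}. step u k = w"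
        using neg y True by blast+
      obtain B where B: "y = add_mset q B" using q(1) by (metis insert_DiffM)
      have "{#k \<in># B. step u k = w#} = B" using all B by (simp add: filter_mset_eq_conv)
      then show ?thesis using uses_top[OF l, of w] top q(3) B by (simp add: slack_def)
    next
      case False
      then have "{#i \<in># y. u \<preceq> i \<and> step u i = w#} = {#i \<in># y. u \<preceq> i#}"
        by (intro filter_mset_cong) auto
      then have "uses y u w = passes y u" using True by (simp add: uses_def passes_def)
      then show ?thesis using passes_top[OF l] by (auto simp: slack_def)
    qed
  next
    case False
    then have "top_of y \<noteq> u" by auto
    then show ?thesis using False by (simp add: slack_def passes_def)
  qed
  then have 1: "(\<Sum>y\<in>#N. slack u y) \<le> (\<Sum>y\<in>#N. uses y u w)" by (intro sum_mset_mono)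
  have "linked y" if "y \<in># N''" for y using that N ad by (auto simp: admissible_def)
  then have 2: "(\<Sum>y\<in>#N''. uses y u w) \<le> (\<Sum>y\<in>#N''. slack u y)"
    using w by (intro sum_mset_mono uses_le_slack) auto
  have 3: "slack u x = slack u x'" using x by (simp add: slack_def)
  have 4: "(\<Sum>y\<in>#M. uses y u w) = (\<Sum>y\<in>#N'. uses y u w)" using st by (simp add: same_type_def)
  show False using 1 2 3 4 w same_type_slack[OF st ad, of u] unfolding M N by simp
qed

text \<open>A surplus token \<open>i\<close> of \<open>x\<close>, heading to \<open>w'\<close>, is
  replaced by a token \<open>j\<close> heading to \<open>w\<close>. Several exchanges may be needed,
  because the multiset that owns \<open>j\<close> may be unable to accept \<open>i\<close> at
  first.\<close>

lemma swap_exists_at_top: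
  assumes M: "M = add_mset x N" and N': "N' = add_mset x' N''"
    and ad: "admissible M" "admissible N'" and st: "same_type M N'"
    and top: "top_of x = u" "top_of x' = u" "size x = size x'"
    and less: "uses x u w < uses x' u w" "uses x' u w' < uses x u w'"
    and i: "x = add_mset i A" "u \<preceq> i" "step u i = w'"
  shows "\<exists>j M'. swap\<^sup>*\<^sup>* M M' \<and> add_mset j A \<in># M' \<and> top_of (add_mset j A) = u \<and> u \<preceq> j \<and> step u j = w"
proof -
  have l: "linked x" "linked x'" using ad M N' by (auto simp: admissible_def)
  have ww: "w \<noteq> w'" using less by auto
  \<comment> \<open>On the side of \<open>x\<close> the exchange is never forbidden: if all of
    \<open>A\<close> went to the child \<open>w\<close>, then \<open>x\<close> would already send
    all but one token there, and \<open>x'\<close>, of the same size, cannot send more.\<close>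
  have okA: "j = u \<or> (\<exists>q\<in>#A. step u q \<noteq> step u j)" if j: "u \<preceq> j" "step u j = w" for j
  proof (rule ccontr)
    assume "\<not> ?thesis"
    then have jn: "j \<noteq> u" and all: "\<forall>q\<in>#A. step u q = w" using j by auto
    then have "w \<noteq> u" using j step_eq_self_iff by metis
    then have "uses x' u w < size x'" using uses_top_less[OF l(2)] top by auto
    moreover have "{#k \<in># A. step u k = w#} = A" using all by (simp add: filter_mset_eq_conv)
    then have "uses x u w = size A" using uses_top[OF l(1), of w] top i ww by simp
    ultimately show False using less(1) top(3) i(1) by simp
  qed
  have exch: "swap K (add_mset (add_mset j A) (add_mset (add_mset i B) R)) \<and> top_of (add_mset j A) = u"
    if K: "K = add_mset x (add_mset (add_mset j B) R)" and B: "linked (add_mset j B)"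
      and j: "top_of (add_mset j B) \<preceq> u" "u \<preceq> j" "step u j = w"
      and ok: "top_of (add_mset j B) = u \<Longrightarrow> i = u \<or> (\<exists>q\<in>#B. step u q \<noteq> w')" for K R j B
  proof -
    have 1: "linked (add_mset j A) \<and> top_of (add_mset j A) = u"
      using top_of_exchange_at[of i A u j] l top i j okA by auto
    have 2: "linked (add_mset i B) \<and> top_of (add_mset i B) = top_of (add_mset j B)"
      using exchange_top_cases[OF B j(1,2) i(2)] ok i(3) by blast
    have "swap K (add_mset (add_mset j A) (add_mset (add_mset i B) R))"
      unfolding K i(1) using 1 2 B l i j top by (intro swap.intros[where v = u]) auto
    then show ?thesis using 1 by blast
  qed
  have direct: ?thesis
    if y: "y \<in># N" "j \<in># y" "top_of y \<preceq> u" "u \<preceq> j" "step u j = w"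
      and ok: "top_of y = u \<Longrightarrow> i = u \<or> (\<exists>q\<in>#y - {#j#}. step u q \<noteq> w')" for y j
  proof -
    obtain B R where B: "y = add_mset j B" "N = add_mset y R" using y by (metis insert_DiffM)
    have "linked y" using y ad M by (auto simp: admissible_def)
    then have "swap M (add_mset (add_mset j A) (add_mset (add_mset i B) R)) \<and> top_of (add_mset j A) = u"
      using y ok B M by (intro exch) auto
    then show ?thesis using y
      by (intro exI[of _ j] exI[of _ "add_mset (add_mset j A) (add_mset (add_mset i B) R)"]) auto
  qed
  have "uses x u w < (\<Sum>z\<in>#N'. uses z u w)" using less(1) N' by simp
  moreover have "(\<Sum>z\<in>#N'. uses z u w) = uses x u w + (\<Sum>z\<in>#N. uses z u w)"
    using st unfolding same_type_def by (simp add: M)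
  ultimately have "0 < (\<Sum>z\<in>#N. uses z u w)" by simp
  then obtain y where y: "y \<in># N" "uses y u w > 0"
    using sum_mset_mono_strict_ex[of "\<lambda>_. 0" N "\<lambda>z. uses z u w"] by auto
  then obtain j where j: "j \<in># y" "top_of y \<preceq> u" "u \<preceq> j" "step u j = w" by (auto elim: uses_pos)
  show ?thesis
  proof (cases "top_of y = u \<longrightarrow> i = u \<or> (\<exists>q\<in>#y - {#j#}. step u q \<noteq> w')")
    case True
    then show ?thesis using direct y j by blast
  next
    case False
    then have ytop: "top_of y = u" and iu: "i \<noteq> u" and all: "\<forall>q\<in>#y - {#j#}. step u q = w'" by auto
    have wu: "w' \<noteq> u" using i iu step_eq_self_iff by metis
    \<comment> \<open>All tokens of \<open>y\<close> except \<open>j\<close> go to the child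
      \<open>w'\<close>, so accepting \<open>i\<close> would move its top. A third multiset
      \<open>z\<close> can accept a token heading to \<open>w'\<close> in return for
      \<open>q\<close>.\<close>
    obtain z q where z: "z \<in># N" "q \<in># z" "top_of z \<preceq> u" "u \<preceq> q" "step u q \<noteq> w'"
      and okz: "top_of z = u \<longrightarrow> (\<exists>k\<in>#z - {#q#}. step u k \<noteq> w')"
      using exists_receiver[OF M N' ad st top wu less(2)] by blast
    show ?thesis
    \<comment> \<open>If \<open>q\<close> heads to \<open>w\<close>, it serves in place of
      \<open>j\<close>. Otherwise \<open>z\<close> and \<open>y\<close> first exchange
      \<open>q\<close> with a token \<open>k\<close> heading to \<open>w'\<close>; afterwards
      \<open>q\<close> keeps the top of \<open>y\<close> at \<open>u\<close>, and \<open>j\<close>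
      can be exchanged with \<open>i\<close>.\<close>
    proof (cases "step u q = w")
      case True
      then show ?thesis using direct z okz by blast
    next
      case qw: False
      have yad: "linked y" "size y \<ge> 2" using y ad M by (auto simp: admissible_def)
      obtain B where B: "y = add_mset j B" using j by (metis insert_DiffM)
      then obtain k B' where k: "B = add_mset k B'" using yad(2) by (cases B) auto
      have kw: "step u k = w'" "u \<preceq> k" using all B k top_of_reaches[OF yad(1), of k] ytop by auto
      \<comment> \<open>The only token of \<open>y\<close> not heading to \<open>w'\<close> is
        \<open>j\<close>, which heads to \<open>w\<close>, whereas \<open>q\<close> heads to
        neither.\<close>
      have "z \<noteq> y"
      proof
        assume "z = y"
        then have "q = j \<or> q \<in># y - {#j#}" using z(2) B by auto
        then show False using qw j all z(5) by auto
      qed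
      then obtain R where R: "N = add_mset y (add_mset z R)"
        using y(1) z(1) by (metis insert_DiffM insert_noteq_member)
      obtain C where C: "z = add_mset q C" using z by (metis insert_DiffM)
      have lz: "linked z" using z ad M by (auto simp: admissible_def)
      have 1: "linked (add_mset q (add_mset j B')) \<and> top_of (add_mset q (add_mset j B')) = top_of y"
        using exchange_top_cases[of k "add_mset j B'" u q] yad ytop kw z qw j unfolding B k
        by (auto simp: add_mset_commute)
      have 2: "linked (add_mset k C) \<and> top_of (add_mset k C) = top_of z"
        using exchange_top_cases[of q C u k] lz z okz kw unfolding C by auto
      let ?K = "add_mset (add_mset q (add_mset j B')) (add_mset (add_mset k C) (add_mset x R))"
      have "swap (add_mset (add_mset k (add_mset j B')) (add_mset (add_mset q C) (add_mset x R))) ?K"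
        using 1 2 yad lz z kw ytop unfolding B k C
        by (intro swap.intros[where v = u]) (auto simp: add_mset_commute)
      moreover have "M = add_mset (add_mset k (add_mset j B')) (add_mset (add_mset q C) (add_mset x R))"
        unfolding M R B k C by (simp add: add_mset_commute)
      ultimately have s1: "swap M ?K" by simp
      have "?K = add_mset x (add_mset (add_mset j (add_mset q B')) (add_mset (add_mset k C) R))"
        by (simp add: add_mset_commute)
      then have "swap ?K (add_mset (add_mset j A) (add_mset (add_mset i (add_mset q B')) (add_mset (add_mset k C) R)))
          \<and> top_of (add_mset j A) = u"
        using 1 ytop j z(5) by (intro exch) (auto simp: add_mset_commute)
      then show ?thesis using s1 j
        by (intro exI[of _ j] exI[of _ "add_mset (add_mset j A)
          (add_mset (add_mset i (add_mset q B')) (add_mset (add_mset k C) R))"])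
          (auto intro: converse_rtranclp_into_rtranclp)
    qed
  qed
qed

text \<open>The termination measure for correcting \<open>x\<close> at \<open>v\<close>. Truncated
  subtraction counts only the destinations that get too few tokens, so moving a token from a surplus
  to a shortage decreases it.\<close>

definition deficit :: "'v multiset \<Rightarrow> 'v \<Rightarrow> 'v multiset \<Rightarrow> nat" where
  "deficit x' v x = (\<Sum>w\<in>UNIV. uses x' v w - uses x v w)"

lemma uses_replace:
  assumes "top_of (add_mset i A) = u" "top_of (add_mset j A) = u" "u \<preceq> v" "v \<preceq> i" "v \<preceq> j"
  shows "uses (add_mset j A) v z + (if step v i = z then 1 else 0) =
    uses (add_mset i A) v z + (if step v j = z then 1 else 0)"
  using assms by (simp add: uses_add_mset)

lemma deficit_decreases:
  assumes "top_of (add_mset i A) = u" "top_of (add_mset j A) = u" "u \<preceq> v" "v \<preceq> i" "v \<preceq> j"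
    and "uses (add_mset i A) v (step v j) < uses x' v (step v j)"
    and "uses x' v (step v i) < uses (add_mset i A) v (step v i)"
  shows "deficit x' v (add_mset j A) < deficit x' v (add_mset i A)"
  unfolding deficit_def
proof (rule sum_strict_mono_ex1)
  show "\<forall>z\<in>UNIV. uses x' v z - uses (add_mset j A) v z \<le> uses x' v z - uses (add_mset i A) v z"
  proof
    fix z show "uses x' v z - uses (add_mset j A) v z \<le> uses x' v z - uses (add_mset i A) v z"
      using uses_replace[OF assms(1-5), of z] assms(6,7) by (auto split: if_splits)
  qed
  have "uses x' v (step v j) - uses (add_mset j A) v (step v j) <
      uses x' v (step v j) - uses (add_mset i A) v (step v j)"
    using uses_replace[OF assms(1-5), of "step v j"] assms(6,7) by (auto split: if_splits)
  then show "\<exists>z\<in>UNIV. uses x' v z - uses (add_mset j A) v z < uses x' v z - uses (add_mset i A) v z"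
    by blast
qed simp

text \<open>Choosing \<open>u\<close> lowest among the tops makes every trek that enters a vertex strictly below \<open>u\<close>
  freely exchangeable there; only at \<open>u\<close> itself do the tops constrain the exchanges.\<close>

lemma agree_at_vertex:
  assumes N': "N' = add_mset x' N''" and ad': "admissible N'"
    and u: "top_of x' = u" "\<And>z. z \<in># N' \<Longrightarrow> u \<preceq> top_of z \<Longrightarrow> top_of z = u"
    and v: "u \<preceq> v"
  shows "admissible M \<Longrightarrow> same_type M N' \<Longrightarrow> x \<in># M \<Longrightarrow> top_of x = u \<Longrightarrow> size x = size x' \<Longrightarrow>
    passes x v = passes x' v \<Longrightarrow>
    \<exists>M' y. swap\<^sup>*\<^sup>* M M' \<and> y \<in># M' \<and> top_of y = u \<and> size y = size x' \<and>
      uses y v = uses x' v \<and> (\<forall>z w. \<not> v \<preceq> z \<longrightarrow> uses y z w = uses x z w)"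
proof (induction "deficit x' v x" arbitrary: x M rule: less_induct)
  case less
  show ?case
  proof (cases "uses x v = uses x' v")
    case False
    then obtain w w' where w: "uses x v w < uses x' v w" "uses x' v w' < uses x v w'"
      using exists_less_and_greater[of "uses x v" "uses x' v"] less.prems(6) by (auto simp: sum_uses)
    have "uses x v w' > 0" using w by simp
    then obtain i where i: "i \<in># x" "top_of x \<preceq> v" "v \<preceq> i" "step v i = w'" by (auto elim: uses_pos)
    obtain A where A: "x = add_mset i A" using i by (metis insert_DiffM)
    obtain N where N: "M = add_mset x N" using less.prems(3) by (metis insert_DiffM)
    have "\<exists>j M'. swap\<^sup>*\<^sup>* M M' \<and> add_mset j A \<in># M' \<and> top_of (add_mset j A) = u \<and> v \<preceq> j \<and> step v j = w"
    proof (cases "v = u")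
      case True
      then show ?thesis
        using swap_exists_at_top[OF N N' less.prems(1) ad' less.prems(2,4) u(1) less.prems(5), of w w' i A] w i A
        by auto
    next
      case False
      \<comment> \<open>The tops of \<open>M\<close> are those of \<open>N'\<close>, none of which
        lies strictly below \<open>u\<close>.\<close>
      have "top_of z \<noteq> v" if "z \<in># M" for z
      proof
        assume "top_of z = v"
        moreover have "top_of z \<in> fst ` set_mset (image_mset (\<lambda>x. (top_of x, size x)) M)"
          using that by force
        moreover have "image_mset (\<lambda>x. (top_of x, size x)) M = image_mset (\<lambda>x. (top_of x, size x)) N'"
          using less.prems(2) by (simp add: same_type_def)
        ultimately have "v \<in> fst ` set_mset (image_mset (\<lambda>x. (top_of x, size x)) N')"
          by metis
        then obtain y where "y \<in># N'" "top_of y = v" by auto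
        then show False using u(2) v False by blast
      qed
      moreover have "uses x v w < (\<Sum>z\<in>#M. uses z v w)"
      proof -
        have "uses x v w < (\<Sum>z\<in>#N'. uses z v w)" using w N' by simp
        then show ?thesis using less.prems(2) by (simp add: same_type_def)
      qed
      ultimately obtain j M' where "swap M M'" "add_mset j A \<in># M'"
        "top_of (add_mset j A) = top_of x" "v \<preceq> j" "step v j = w"
        using swap_exists_off_top[OF N less.prems(1) _ _ A i(2,3), of w] by blast
      then show ?thesis using less.prems(4) by blast
    qed
    then obtain j M' where j: "swap\<^sup>*\<^sup>* M M'" "add_mset j A \<in># M'"
        "top_of (add_mset j A) = u" "v \<preceq> j" "step v j = w" by blast
    have t: "top_of (add_mset i A) = u" using less.prems(4) A by simp
    have "deficit x' v (add_mset j A) < deficit x' v x"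
      unfolding A using deficit_decreases[OF t j(3) v i(3) j(4), of x'] w j(5) i(4) A by simp
    moreover have "admissible M'" using swaps_admissible j(1) less.prems(1) by blast
    moreover have "same_type M' N'"
      using swaps_same_type[OF j(1)] less.prems(2) same_type_trans same_type_sym by blast
    moreover have "passes (add_mset j A) v = passes x' v"
      using less.prems(6) t j(3,4) i(3) v unfolding A passes_def by simp
    ultimately obtain M'' y where y: "swap\<^sup>*\<^sup>* M' M''" "y \<in># M''" "top_of y = u" "size y = size x'"
      "uses y v = uses x' v" "\<forall>z w. \<not> v \<preceq> z \<longrightarrow> uses y z w = uses (add_mset j A) z w"
      using less.hyps[of "add_mset j A" M'] j less.prems(5) A by auto
    moreover have "uses (add_mset j A) z w = uses x z w" if "\<not> v \<preceq> z" for z w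
      using uses_unaffected[OF t j(3) v i(3) j(4) that] A by simp
    ultimately show ?thesis using rtranclp_trans[OF j(1) y(1)]
      by (intro exI[of _ M''] exI[of _ y]) simp
  qed (use less.prems in blast)
qed

text \<open>The multiplicity of \<open>i\<close> in a multiset is the number of its tokens that stop
  at \<open>i\<close>.\<close>

lemma eq_of_uses:
  assumes "linked x" "linked x'" "top_of x = u" "top_of x' = u" "\<And>v. u \<preceq> v \<Longrightarrow> uses x v = uses x' v"
  shows "x = x'"
proof (rule multiset_eqI)
  have *: "count y i = (if u \<preceq> i then uses y i i else 0)" if y: "linked y" "top_of y = u" for y i
  proof (cases "u \<preceq> i")
    case True
    have "{#k \<in># y. i \<preceq> k \<and> step i k = i#} = {#k \<in># y. k = i#}"
      by (rule filter_mset_cong) (auto simp: step_eq_self_iff)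
    then show ?thesis using True y
      by (simp add: uses_def filter_eq_replicate_mset)
  next
    case False
    then have "i \<notin># y" using y top_of_reaches[OF y(1), of i] by auto
    then show ?thesis using False by (simp add: not_in_iff)
  qed
  fix i show "count x i = count x' i" using *[of x i] *[of x' i] assms by simp
qed

text \<open>\<open>D\<close> collects the vertices where \<open>x\<close> already agrees with
  \<open>x'\<close>. It is closed upwards as far as \<open>u\<close>, so no vertex of
  \<open>D\<close> lies below a new vertex \<open>v\<close>, and corrections at \<open>v\<close>
  leave the counts on \<open>D\<close> intact.\<close>

lemma swaps_to_contain:
  assumes N': "N' = add_mset x' N''" and ad': "admissible N'"
    and u: "top_of x' = u" "\<And>z. z \<in># N' \<Longrightarrow> u \<preceq> top_of z \<Longrightarrow> top_of z = u"
  shows "admissible M \<Longrightarrow> same_type M N' \<Longrightarrow> x \<in># M \<Longrightarrow> top_of x = u \<Longrightarrow> size x = size x' \<Longrightarrow>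
    (\<forall>v\<in>D. uses x v = uses x' v) \<Longrightarrow> (\<forall>v\<in>D. \<forall>y. u \<preceq> y \<longrightarrow> y \<preceq> v \<longrightarrow> y \<in> D) \<Longrightarrow>
    \<exists>M'. swap\<^sup>*\<^sup>* M M' \<and> x' \<in># M'"
proof (induction "card (- D)" arbitrary: D M x rule: less_induct)
  case less
  have l: "linked x" "linked x'" using less.prems(1,3) N' ad' by (auto simp: admissible_def)
  show ?case
  proof (cases "\<forall>v. u \<preceq> v \<longrightarrow> v \<in> D")
    case True
    then have "x = x'" using eq_of_uses[OF l less.prems(4) u(1)] less.prems(6) by blast
    then show ?thesis using less.prems(3) by blast
  next
    case False
    then obtain v0 where "v0 \<in> {v. u \<preceq> v \<and> v \<notin> D}" by blast
    from wfE_min[OF wf_edges(1) this]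
    obtain v where v: "u \<preceq> v" "v \<notin> D" and min: "\<And>p. (p, v) \<in> E \<Longrightarrow> u \<preceq> p \<Longrightarrow> p \<in> D"
      by (metis (no_types, lifting) mem_Collect_eq)
    \<comment> \<open>At \<open>u\<close> all tokens are present and the sizes agree. Elsewhere the
      tokens arriving at \<open>v\<close> are those sent by its parent below \<open>u\<close>, which
      is in \<open>D\<close> by the choice of \<open>v\<close>.\<close>
    have "passes x v = passes x' v"
    proof (cases "v = u")
      case True
      then show ?thesis using passes_top l less.prems(4,5) u(1) by metis
    next
      case False
      then obtain p where p: "u \<preceq> p" "(p, v) \<in> E" using v(1) reaches_last by blast
      then have "p \<in> D" using min by blast
      then show ?thesis using passes_eq_uses_parent[OF p(2)] p(1) less.prems(4,6) u(1) by simp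
    qed
    from agree_at_vertex[OF N' ad' u v(1) less.prems(1-5) this]
    obtain M' y where y: "swap\<^sup>*\<^sup>* M M'" "y \<in># M'" "top_of y = u" "size y = size x'"
      "uses y v = uses x' v" "\<forall>z w. \<not> v \<preceq> z \<longrightarrow> uses y z w = uses x z w" by blast
    have "uses y z = uses x' z" if "z \<in> insert v D" for z
    proof (cases "z = v")
      case False
      then have "z \<in> D" using that by simp
      then have "\<not> v \<preceq> z" using less.prems(7) v by blast
      then show ?thesis using y(6) less.prems(6) \<open>z \<in> D\<close> by auto
    qed (use y in simp)
    moreover have "z \<in> insert v D" if z: "u \<preceq> z" "z \<preceq> v" for z
    proof (cases "z = v")
      case False
      then obtain p where "z \<preceq> p" "(p, v) \<in> E" using z(2) reaches_last by blast
      moreover from this have "p \<in> D" using min z(1) reaches_trans by blast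
      ultimately show ?thesis using less.prems(7) z(1) by blast
    qed simp
    moreover have "card (- insert v D) < card (- D)"
      using v(2) by (intro psubset_card_mono) auto
    moreover have "admissible M'" using swaps_admissible y(1) less.prems(1) by blast
    moreover have "same_type M' N'"
      using swaps_same_type[OF y(1)] less.prems(2) same_type_trans same_type_sym by blast
    ultimately have "\<exists>M''. swap\<^sup>*\<^sup>* M' M'' \<and> x' \<in># M''"
      using y(2-4) less.prems(7) by (intro less.hyps[of "insert v D" M' y]) auto
    then show ?thesis using y(1) by (meson rtranclp_trans)
  qed
qed

text \<open>In the language of toric ideals, the exchanges form a Markov basis. Once
  \<open>x'\<close> occurs on both sides it is cancelled, which lowers the degree.\<close>

theorem same_type_imp_swaps:
  assumes "admissible M" "admissible N" "same_type M N"
  shows "swap\<^sup>*\<^sup>* M N"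
  using assms
proof (induction "size N" arbitrary: M N)
  case 0
  then show ?case by (simp add: same_type_def)
next
  case (Suc n)
  have "top_of ` set_mset N \<noteq> {}" using Suc.hyps(2) by auto
  then obtain u0 where "u0 \<in> top_of ` set_mset N" by blast
  \<comment> \<open>Minimality for the transitive closure of the reversed edges means that no other
    top of \<open>N\<close> lies below \<open>u\<close>.\<close>
  from wfE_min[OF wf_trancl[OF wf_edges(2)] this]
  obtain u where u: "u \<in> top_of ` set_mset N"
    and "\<And>y. (y, u) \<in> (E\<inverse>)\<^sup>+ \<Longrightarrow> y \<notin> top_of ` set_mset N" by metis
  then have max: "\<And>y. (u, y) \<in> E\<^sup>+ \<Longrightarrow> y \<notin> top_of ` set_mset N"
    by (simp add: trancl_converse)
  obtain x' where x': "x' \<in># N" "top_of x' = u" using u by blast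
  then obtain N'' where N: "N = add_mset x' N''" by (metis insert_DiffM)
  have low: "top_of z = u" if "z \<in># N" "u \<preceq> top_of z" for z
    using max[of "top_of z"] that by (auto simp: reaches_def rtrancl_eq_or_trancl)
  have "(u, size x') \<in> set_mset (image_mset (\<lambda>x. (top_of x, size x)) M)"
    using Suc.prems(3) x' by (force simp: same_type_def)
  then obtain x where x: "x \<in># M" "top_of x = u" "size x = size x'" by auto
  obtain M' where M': "swap\<^sup>*\<^sup>* M M'" "x' \<in># M'"
    using swaps_to_contain[OF N Suc.prems(2) x'(2) low Suc.prems(1,3) x, of "{}"] by auto
  then obtain M'' where M'': "M' = add_mset x' M''" by (metis insert_DiffM)
  have "same_type M' N"
    using swaps_same_type[OF M'(1)] Suc.prems(3) same_type_trans same_type_sym by blast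
  then have "same_type M'' N''" unfolding M'' N same_type_def by simp
  moreover have "admissible M''" "admissible N''"
    using swaps_admissible[OF M'(1) Suc.prems(1)] Suc.prems(2) unfolding M'' N by (auto simp: admissible_def)
  ultimately have "swap\<^sup>*\<^sup>* M'' N''" using Suc.hyps N by simp
  then show ?case using M'(1) swaps_add_mset unfolding M'' N by (meson rtranclp_trans)
qed

end

section \<open>Moments of the model\<close>

text \<open>Second and third moments at once: \<open>W 2\<close> and \<open>W 3\<close> are the
  diagonals of the two error tensors, and the number of indices selects between them.\<close>

definition diag_moment :: "(nat \<Rightarrow> 'v \<Rightarrow> real) \<Rightarrow> real^'v^'v \<Rightarrow> 'v::finite multiset \<Rightarrow> real" where
  "diag_moment W M x = (\<Sum>a\<in>UNIV. W (size x) a * (\<Prod>i\<in>#x. M $ a $ i))"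

lemma transpose_diagonal_mult:
  fixes M W :: "real^'v::finite^'v"
  assumes "diagonal2 W"
  shows "(transpose M ** W ** M) $ i $ j = (\<Sum>a\<in>UNIV. W $ a $ a * (M $ a $ i * M $ a $ j))"
proof -
  have "(transpose M ** W ** M) $ i $ j = (\<Sum>b\<in>UNIV. (\<Sum>a\<in>UNIV. M $ a $ i * W $ a $ b) * M $ b $ j)"
    by (simp add: matrix_matrix_mult_def transpose_def)
  also have "\<dots> = (\<Sum>b\<in>UNIV. W $ b $ b * (M $ b $ i * M $ b $ j))"
  proof (rule sum.cong)
    fix b
    have "(\<Sum>a\<in>UNIV. M $ a $ i * W $ a $ b) = (\<Sum>a\<in>{b}. M $ a $ i * W $ a $ b)"
      using assms by (intro sum.mono_neutral_right) (auto simp: diagonal2_def)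
    then show "(\<Sum>a\<in>UNIV. M $ a $ i * W $ a $ b) * M $ b $ j = W $ b $ b * (M $ b $ i * M $ b $ j)"
      by simp
  qed simp
  finally show ?thesis .
qed

lemma diagonal3_zero: "diagonal3 W \<Longrightarrow> \<not> (a = b \<and> b = c) \<Longrightarrow> W $ a $ b $ c = 0"
  unfolding diagonal3_def by metis

lemma tucker3_diagonal:
  fixes M :: "real^'v::finite^'v"
  assumes "diagonal3 W"
  shows "tucker3 W M M M $ i $ j $ k = (\<Sum>a\<in>UNIV. W $ a $ a $ a * (M $ a $ i * (M $ a $ j * M $ a $ k)))"
proof -
  have "(\<Sum>b\<in>UNIV. \<Sum>c\<in>UNIV. W $ a $ b $ c * M $ a $ i * M $ b $ j * M $ c $ k) =
      W $ a $ a $ a * (M $ a $ i * (M $ a $ j * M $ a $ k))" for a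
  proof -
    have "(\<Sum>c\<in>UNIV. W $ a $ b $ c * M $ a $ i * M $ b $ j * M $ c $ k) =
        (if b = a then W $ a $ a $ a * M $ a $ i * M $ a $ j * M $ a $ k else 0)" for b
    proof -
      have "(\<Sum>c\<in>UNIV. W $ a $ b $ c * M $ a $ i * M $ b $ j * M $ c $ k) =
          (\<Sum>c\<in>{a}. W $ a $ b $ c * M $ a $ i * M $ b $ j * M $ c $ k)"
      proof (rule sum.mono_neutral_right)
        have "W $ a $ b $ c = 0" if "c \<noteq> a" for c
          using that by (intro diagonal3_zero[OF assms]) auto
        then show "\<forall>c\<in>UNIV - {a}. W $ a $ b $ c * M $ a $ i * M $ b $ j * M $ c $ k = 0" by simp
      qed auto
      moreover have "W $ a $ b $ a = 0" if "b \<noteq> a"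
        using that by (intro diagonal3_zero[OF assms]) auto
      ultimately show ?thesis by simp
    qed
    then show ?thesis by simp
  qed
  then show ?thesis by (simp add: tucker3_def)
qed

lemma moment_model_diag_moment:
  assumes "(S, T) \<in> moment_model E"
  obtains L W where "L \<in> edge_matrices E"
    "\<And>i j. S $ i $ j = diag_moment W (matrix_inv (mat 1 - L)) {#i, j#}"
    "\<And>i j k. T $ i $ j $ k = diag_moment W (matrix_inv (mat 1 - L)) {#i, j, k#}"
proof -
  from assms obtain L W2 W3 where *: "L \<in> edge_matrices E" "diagonal2 W2" "diagonal3 W3"
    "S = transpose (matrix_inv (mat 1 - L)) ** W2 ** matrix_inv (mat 1 - L)"
    "T = tucker3 W3 (matrix_inv (mat 1 - L)) (matrix_inv (mat 1 - L)) (matrix_inv (mat 1 - L))"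
    unfolding moment_model_def by auto
  let ?W = "\<lambda>n a. if n = 2 then W2 $ a $ a else W3 $ a $ a $ a"
  show ?thesis
    by (rule that[OF *(1), of ?W])
      (simp_all add: *(4,5) transpose_diagonal_mult[OF *(2)] tucker3_diagonal[OF *(3)] diag_moment_def)
qed

lemma diagonal_PD:
  fixes w :: "'v::finite \<Rightarrow> real"
  assumes "\<And>a. w a > 0"
  shows "(\<chi> i j. if i = j then w i else 0) \<in> PD"
proof -
  let ?D = "(\<chi> i j. if i = j then w i else 0) :: real^'v^'v"
  have "x \<bullet> (?D *v x) > 0" if "x \<noteq> 0" for x
  proof -
    have "?D *v x = (\<chi> i. w i * x $ i)"
      by (simp add: matrix_vector_mult_def vec_eq_iff if_distrib[of "\<lambda>t. t * _"] cong: if_cong)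
    then have "x \<bullet> (?D *v x) = (\<Sum>i\<in>UNIV. w i * (x $ i)\<^sup>2)"
      by (simp add: inner_vec_def power2_eq_square algebra_simps)
    moreover have "\<exists>i. x $ i \<noteq> 0" using that by (simp add: vec_eq_iff)
    then obtain i where "x $ i \<noteq> 0" ..
    then have "0 < (\<Sum>i\<in>UNIV. w i * (x $ i)\<^sup>2)"
      using assms by (intro sum_pos2[where i = i]) (auto simp: less_imp_le)
    ultimately show ?thesis by simp
  qed
  then show ?thesis by (auto simp: PD_def transpose_def vec_eq_iff)
qed

lemma diag_moment_in_model:
  fixes W :: "nat \<Rightarrow> 'v::finite \<Rightarrow> real"
  assumes "L \<in> edge_matrices E" "\<And>a. W 2 a > 0"
  defines "M \<equiv> matrix_inv (mat 1 - L)"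
  shows "((\<chi> i j. diag_moment W M {#i, j#}), (\<chi> i j k. diag_moment W M {#i, j, k#})) \<in> moment_model E"
proof -
  let ?W2 = "(\<chi> i j. if i = j then W 2 i else 0) :: real^'v^'v"
  let ?W3 = "(\<chi> i j k. if i = j \<and> j = k then W 3 i else 0) :: real^'v^'v^'v"
  have d: "diagonal2 ?W2" "diagonal3 ?W3" by (auto simp: diagonal2_def diagonal3_def)
  have "(\<chi> i j. diag_moment W M {#i, j#}) = transpose M ** ?W2 ** M"
    by (simp add: vec_eq_iff transpose_diagonal_mult[OF d(1)] diag_moment_def numeral_2_eq_2)
  moreover have "(\<chi> i j k. diag_moment W M {#i, j, k#}) = tucker3 ?W3 M M M"
    by (simp add: vec_eq_iff tucker3_diagonal[OF d(2)] diag_moment_def numeral_3_eq_3)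
  moreover have "?W3 \<in> Sym3" by (auto simp: Sym3_def)
  ultimately show ?thesis
    unfolding moment_model_def M_def using assms(1) d diagonal_PD[OF assms(2)]
    by (intro CollectI case_prodI exI[of _ L] exI[of _ ?W2] exI[of _ ?W3] conjI)
qed

section \<open>Entries of the inverse of I - L and the trek rule\<close>

context polytree_graph begin

context
  fixes L :: "real^'v^'v"
  assumes L: "L \<in> edge_matrices E"
begin

lemma edge_matrix_zero: "(i, j) \<notin> E \<Longrightarrow> L $ i $ j = 0"
  using L by (simp add: edge_matrices_def)

text \<open>A kernel vector satisfies \<open>x = L *v x\<close>, so each entry is a combination of
  the entries at the children and vanishes by induction from the sinks upwards.\<close>

lemma invertible_one_minus: "invertible (mat 1 - L)"
proof -
  have "x = 0" if x: "(mat 1 - L) *v x = 0" for x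
  proof -
    have eq: "x $ i = (\<Sum>j\<in>UNIV. L $ i $ j * x $ j)" for i
    proof -
      have "x - L *v x = 0" using x by (simp add: matrix_vector_mult_diff_rdistrib)
      then have "x $ i = (L *v x) $ i" by simp
      then show ?thesis by (simp add: matrix_vector_mult_def)
    qed
    have "x $ i = 0" for i
    proof (induction i rule: wf_induct_rule[OF wf_edges(2)])
      case (1 i)
      have "L $ i $ j * x $ j = 0" for j
        using 1[of j] edge_matrix_zero[of i j] by (cases "(i, j) \<in> E") auto
      then have "(\<Sum>j\<in>UNIV. L $ i $ j * x $ j) = 0" by (intro sum.neutral) blast
      then show ?case using eq[of i] by simp
    qed
    then show ?thesis by (simp add: vec_eq_iff)
  qed
  then show ?thesis
    using invertible_left_inverse matrix_left_invertible_ker by blast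
qed

text \<open>In general this entry is the sum, over the directed paths from \<open>u\<close> to
  \<open>i\<close>, of the products of the edge coefficients; a polytree has at most one such path,
  see \<open>path_weight_prod\<close>.\<close>

abbreviation (input) path_weight :: "'v \<Rightarrow> 'v \<Rightarrow> real" where
  "path_weight u i \<equiv> matrix_inv (mat 1 - L) $ u $ i"

lemma path_weight_rec:
  "path_weight u i = (if u = i then 1 else 0) + (\<Sum>p\<in>{p. (p, i) \<in> E}. path_weight u p * L $ p $ i)"
proof -
  let ?M = "matrix_inv (mat 1 - L)"
  have "?M ** (mat 1 - L) = mat 1"
    using someI_ex[OF invertible_one_minus[unfolded invertible_def]] unfolding matrix_inv_def by blast
  then have "(?M ** (mat 1 - L)) $ u $ i = mat 1 $ u $ i" by simp
  moreover have "(?M ** (mat 1 - L)) $ u $ i = (\<Sum>p\<in>UNIV. ?M $ u $ p * (mat 1 $ p $ i - L $ p $ i))"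
    by (simp add: matrix_matrix_mult_def)
  moreover have "\<dots> = (\<Sum>p\<in>UNIV. ?M $ u $ p * mat 1 $ p $ i) - (\<Sum>p\<in>UNIV. ?M $ u $ p * L $ p $ i)"
    by (simp add: right_diff_distrib sum_subtractf)
  moreover have "(\<Sum>p\<in>UNIV. ?M $ u $ p * mat 1 $ p $ i) = ?M $ u $ i"
    by (simp add: mat_def if_distrib[of "\<lambda>t. _ * t"] cong: if_cong)
  moreover have "(\<Sum>p\<in>UNIV. ?M $ u $ p * L $ p $ i) = (\<Sum>p\<in>{p. (p, i) \<in> E}. ?M $ u $ p * L $ p $ i)"
    by (rule sum.mono_neutral_right) (auto simp: edge_matrix_zero)
  ultimately show ?thesis by (simp add: mat_def)
qed

lemma path_weight_zero: "\<not> u \<preceq> i \<Longrightarrow> path_weight u i = 0"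
proof (induction i rule: wf_induct_rule[OF wf_edges(1)])
  case (1 i)
  have "path_weight u p = 0" if "(p, i) \<in> E" for p
    using 1 that edge_reaches reaches_trans by blast
  then have "(\<Sum>p\<in>{p. (p, i) \<in> E}. path_weight u p * L $ p $ i) = 0" by (intro sum.neutral) simp
  moreover have "u \<noteq> i" using 1 by auto
  ultimately show ?case using path_weight_rec[of u i] by simp
qed

lemma path_weight_self: "path_weight u u = 1"
proof -
  have "path_weight u p = 0" if "(p, u) \<in> E" for p
    using path_weight_zero edge_not_reaches that by blast
  then have "(\<Sum>p\<in>{p. (p, u) \<in> E}. path_weight u p * L $ p $ u) = 0" by (intro sum.neutral) simp
  then show ?thesis using path_weight_rec[of u u] by simp
qed

lemma path_weight_other_parent:
  assumes "u \<preceq> p" "(p, i) \<in> E" "(q, i) \<in> E" "q \<noteq> p"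
  shows "path_weight u q = 0"
  using path_weight_zero unique_parent[OF assms(2,3,1)] assms(4) by blast

lemma path_weight_edge:
  assumes "u \<preceq> p" "(p, i) \<in> E"
  shows "path_weight u i = path_weight u p * L $ p $ i"
proof -
  have "u \<noteq> i" using assms edge_not_reaches by blast
  moreover have "(\<Sum>q\<in>{q. (q, i) \<in> E}. path_weight u q * L $ q $ i) = (\<Sum>q\<in>{p}. path_weight u q * L $ q $ i)"
    by (intro sum.mono_neutral_right) (auto simp: assms(2) path_weight_other_parent[OF assms])
  ultimately show ?thesis using path_weight_rec[of u i] by simp
qed

lemma path_weight_mult: "u \<preceq> v \<Longrightarrow> v \<preceq> i \<Longrightarrow> path_weight u i = path_weight u v * path_weight v i"
proof (induction i rule: wf_induct_rule[OF wf_edges(1)])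
  case (1 i)
  show ?case
  proof (cases "v = i")
    case False
    then obtain p where p: "v \<preceq> p" "(p, i) \<in> E" using 1 reaches_last by blast
    then have "u \<preceq> p" using 1 reaches_trans by blast
    then show ?thesis
      using path_weight_edge[OF _ p(2)] 1 p by simp
  qed (simp add: path_weight_self)
qed

text \<open>The index set is the edge set of the path from \<open>u\<close> to \<open>i\<close>:
  removing the last edge of the path removes exactly one element, because \<open>i\<close> has only
  one parent below \<open>u\<close>.\<close>

lemma path_weight_prod:
  "u \<preceq> i \<Longrightarrow> path_weight u i = (\<Prod>(v, w)\<in>{(v, w)\<in>E. u \<preceq> v \<and> w \<preceq> i}. L $ v $ w)"
proof (induction i rule: wf_induct_rule[OF wf_edges(1)])
  case (1 i)
  show ?case
  proof (cases "u = i")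
    case True
    then have "{(v, w)\<in>E. u \<preceq> v \<and> w \<preceq> i} = {}"
      using edge_not_reaches reaches_trans by blast
    then show ?thesis by (simp only: True path_weight_self) simp
  next
    case False
    then obtain p where p: "u \<preceq> p" "(p, i) \<in> E" using 1 reaches_last by blast
    have "w \<preceq> p" if w: "(v, w) \<in> E" "u \<preceq> v" "w \<preceq> i" "(v, w) \<noteq> (p, i)" for v w
    proof (cases "w = i")
      case True
      then show ?thesis using unique_parent[OF w(1)[unfolded True] p(2) w(2) p(1)] w(4) by simp
    next
      case False
      then obtain q where q: "w \<preceq> q" "(q, i) \<in> E" using w(3) reaches_last by blast
      moreover have "u \<preceq> q" using w(1,2) q(1) edge_reaches reaches_trans by blast
      ultimately show ?thesis using unique_parent[OF _ p(2) _ p(1)] by blast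
    qed
    moreover have "w \<preceq> i" if "w \<preceq> p" for w using that p(2) edge_reaches reaches_trans by blast
    ultimately have "{(v, w)\<in>E. u \<preceq> v \<and> w \<preceq> i} = insert (p, i) {(v, w)\<in>E. u \<preceq> v \<and> w \<preceq> p}"
      using p by auto
    moreover have "(p, i) \<notin> {(v, w)\<in>E. u \<preceq> v \<and> w \<preceq> p}" using p(2) edge_not_reaches by auto
    ultimately show ?thesis using path_weight_edge[OF p] 1(1)[OF p(2,1)] by (simp add: mult.commute)
  qed
qed

text \<open>The simple trek rule.\<close>

lemma diag_moment_linked:
  assumes x: "linked x" and u: "top_of x = u"
  shows "diag_moment W (matrix_inv (mat 1 - L)) x =
    diag_moment W (matrix_inv (mat 1 - L)) (replicate_mset (size x) u) * (\<Prod>i\<in>#x. path_weight u i)"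
proof -
  \<comment> \<open>A source \<open>a\<close> above the top reaches every index through
    \<open>u\<close>. Any other source misses some index, and both sides vanish, the right one
    because \<open>size x\<close> is positive.\<close>
  have eq: "(\<Prod>i\<in>#x. path_weight a i) = path_weight a u ^ size x * (\<Prod>i\<in>#x. path_weight u i)" for a
  proof (cases "a \<preceq> u")
    case True
    have *: "(\<Prod>i\<in>#y. path_weight a i) = path_weight a u ^ size y * (\<Prod>i\<in>#y. path_weight u i)"
      if "\<forall>i\<in>#y. u \<preceq> i" for y
      using that
    proof (induction y)
      case (add i y)
      have "u \<preceq> i" using add.prems by simp
      moreover have "(\<Prod>i\<in>#y. path_weight a i) = path_weight a u ^ size y * (\<Prod>i\<in>#y. path_weight u i)"
        using add by simp
      ultimately show ?case using path_weight_mult[OF True, of i] by simp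
    qed simp
    show ?thesis using top_of_reaches[OF x] u by (intro *) blast
  next
    case False
    then obtain i where i: "i \<in># x" "\<not> a \<preceq> i" using reaches_top_of[OF x, of a] u by blast
    then have z: "(\<Prod>i\<in>#x. path_weight a i) = 0"
      by (auto simp: prod_mset_zero_iff path_weight_zero intro!: image_eqI[of _ _ i])
    have "x \<noteq> {#}" using i by auto
    then show ?thesis unfolding z path_weight_zero[OF False] by (simp add: power_0_left)
  qed
  have "(\<Sum>a\<in>UNIV. W (size x) a * (\<Prod>i\<in>#x. path_weight a i)) =
      (\<Sum>a\<in>UNIV. W (size x) a * (path_weight a u ^ size x * (\<Prod>i\<in>#x. path_weight u i)))"
    by (rule sum.cong[OF refl], subst eq, rule refl)
  then show ?thesis by (simp add: diag_moment_def sum_distrib_right mult.assoc)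
qed

lemma diag_moment_not_linked:
  assumes "\<not> linked x" "x \<noteq> {#}" shows "diag_moment W (matrix_inv (mat 1 - L)) x = 0"
proof -
  have "(\<Prod>i\<in>#x. path_weight a i) = 0" for a
  proof -
    obtain i where "i \<in># x" "\<not> a \<preceq> i" using assms linkedI by blast
    then show ?thesis
      by (auto simp: prod_mset_zero_iff path_weight_zero intro!: image_eqI[of _ _ i])
  qed
  then show ?thesis unfolding diag_moment_def by (intro sum.neutral) simp
qed

text \<open>The moment with all \<open>k\<close> indices equal to \<open>u\<close> is the error
  moment of \<open>u\<close> plus, for each parent \<open>p\<close>, \<open>L $ p $ u ^ k\<close>
  times the corresponding moment of \<open>p\<close>. Solving for the error moments shows that these
  moments can be prescribed as arbitrary numbers \<open>c k u\<close>.\<close>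

lemma diag_moment_replicate:
  fixes c :: "nat \<Rightarrow> 'v \<Rightarrow> real"
  assumes k: "k > 0"
  defines "W \<equiv> \<lambda>k u. c k u - (\<Sum>p\<in>{p. (p, u) \<in> E}. L $ p $ u ^ k * c k p)"
  shows "diag_moment W (matrix_inv (mat 1 - L)) (replicate_mset k u) = c k u"
proof (induction u rule: wf_induct_rule[OF wf_edges(1)])
  case (1 u)
  let ?P = "{p. (p, u) \<in> E}"
  \<comment> \<open>The power may be taken termwise, because at most one parent of \<open>u\<close>
    is reachable from \<open>a\<close>, and none if \<open>a = u\<close>.\<close>
  have pow: "path_weight a u ^ k = (if a = u then 1 else 0) + (\<Sum>p\<in>?P. path_weight a p ^ k * L $ p $ u ^ k)" for a
  proof (cases "\<exists>p\<in>?P. a \<preceq> p")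
    case True
    then obtain p where p: "a \<preceq> p" "(p, u) \<in> E" by blast
    then have "a \<noteq> u" using edge_not_reaches by blast
    moreover have "(\<Sum>q\<in>?P. path_weight a q ^ k * L $ q $ u ^ k) = (\<Sum>q\<in>{p}. path_weight a q ^ k * L $ q $ u ^ k)"
      using k by (intro sum.mono_neutral_right) (auto simp: p(2) path_weight_other_parent[OF p])
    ultimately show ?thesis using path_weight_edge[OF p] by (simp add: power_mult_distrib)
  next
    case False
    then have z: "path_weight a p = 0" if "p \<in> ?P" for p using that path_weight_zero by blast
    then have "(\<Sum>p\<in>?P. path_weight a p ^ k * L $ p $ u ^ k) = 0"
      "(\<Sum>p\<in>?P. path_weight a p * L $ p $ u) = 0"
      using k by (auto intro!: sum.neutral)
    then show ?thesis using path_weight_rec[of a u] k by simp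
  qed
  have "diag_moment W (matrix_inv (mat 1 - L)) (replicate_mset k u) =
      (\<Sum>a\<in>UNIV. W k a * ((if a = u then 1 else 0) + (\<Sum>p\<in>?P. path_weight a p ^ k * L $ p $ u ^ k)))"
    by (simp add: diag_moment_def pow)
  also have "\<dots> = W k u + (\<Sum>a\<in>UNIV. \<Sum>p\<in>?P. W k a * (path_weight a p ^ k * L $ p $ u ^ k))"
    by (simp add: distrib_left sum.distrib sum_distrib_left if_distrib[of "\<lambda>t. _ * t"] cong: if_cong)
  also have "(\<Sum>a\<in>UNIV. \<Sum>p\<in>?P. W k a * (path_weight a p ^ k * L $ p $ u ^ k)) =
      (\<Sum>p\<in>?P. L $ p $ u ^ k * (\<Sum>a\<in>UNIV. W k a * path_weight a p ^ k))"
    by (subst sum.swap) (simp add: sum_distrib_left ac_simps)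
  also have "\<dots> = (\<Sum>p\<in>?P. L $ p $ u ^ k * c k p)"
    using 1 by (intro sum.cong) (auto simp: diag_moment_def)
  finally show ?case by (simp add: W_def)
qed

lemma path_weight_prod_uses:
  assumes x: "linked x"
  shows "(\<Prod>i\<in>#x. path_weight (top_of x) i) = (\<Prod>(v, w)\<in>E. L $ v $ w ^ uses x v w)"
proof -
  let ?u = "top_of x"
  \<comment> \<open>The induction over \<open>y\<close> keeps the top of \<open>x\<close> fixed;
    \<open>uses\<close> itself would refer to the changing top of \<open>y\<close>.\<close>
  have *: "(\<Prod>i\<in>#y. path_weight ?u i) =
      (\<Prod>(v, w)\<in>E. L $ v $ w ^ (if ?u \<preceq> v then size {#i \<in># y. w \<preceq> i#} else 0))"
    if "\<forall>i\<in>#y. ?u \<preceq> i" for y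
    using that
  proof (induction y)
    case (add i y)
    have "path_weight ?u i = (\<Prod>(v, w)\<in>E. if ?u \<preceq> v \<and> w \<preceq> i then L $ v $ w else 1)"
      using add.prems path_weight_prod[of ?u i]
      by (simp add: prod.inter_filter[symmetric] case_prod_unfold)
    moreover have "(\<Prod>i\<in>#y. path_weight ?u i) =
        (\<Prod>(v, w)\<in>E. L $ v $ w ^ (if ?u \<preceq> v then size {#i \<in># y. w \<preceq> i#} else 0))"
      using add by simp
    ultimately have "(\<Prod>i\<in>#add_mset i y. path_weight ?u i) =
        (\<Prod>e\<in>E. (case e of (v, w) \<Rightarrow> if ?u \<preceq> v \<and> w \<preceq> i then L $ v $ w else 1) *
          (case e of (v, w) \<Rightarrow> L $ v $ w ^ (if ?u \<preceq> v then size {#i \<in># y. w \<preceq> i#} else 0)))"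
      by (simp add: prod.distrib)
    also have "\<dots> = (\<Prod>(v, w)\<in>E. L $ v $ w ^ (if ?u \<preceq> v then size {#k \<in># add_mset i y. w \<preceq> k#} else 0))"
      by (rule prod.cong) auto
    finally show ?case .
  qed (simp add: case_prod_unfold cong: if_cong)
  have "(if ?u \<preceq> v then size {#i \<in># x. w \<preceq> i#} else 0) = uses x v w" if "(v, w) \<in> E" for v w
    unfolding uses_def step_eq_child_iff[OF that] ..
  moreover have "\<forall>i\<in>#x. ?u \<preceq> i" using top_of_reaches[OF x] by blast
  ultimately show ?thesis unfolding *[OF \<open>\<forall>i\<in>#x. ?u \<preceq> i\<close>] by (intro prod.cong) auto
qed

end
end

section \<open>Separating the moment monomials\<close>

lemma digits_unique:
  fixes K :: nat
  assumes "\<And>t. t < N \<Longrightarrow> d t < K" "\<And>t. t < N \<Longrightarrow> d' t < K"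
    and "(\<Sum>t<N. d t * K ^ t) = (\<Sum>t<N. d' t * K ^ t)" "t < N"
  shows "d t = d' t"
  using assms
proof (induction N arbitrary: d d' t)
  case (Suc N)
  have split: "(\<Sum>t<Suc N. f t * K ^ t) = f 0 + K * (\<Sum>t<N. f (Suc t) * K ^ t)" for f
    by (simp only: sum.lessThan_Suc_shift sum_distrib_left) (simp add: ac_simps)
  have eq: "d 0 + K * (\<Sum>t<N. d (Suc t) * K ^ t) = d' 0 + K * (\<Sum>t<N. d' (Suc t) * K ^ t)"
    using Suc.prems(3) unfolding split .
  have K: "d 0 < K" "d' 0 < K" using Suc.prems(1)[of 0] Suc.prems(2)[of 0] by auto
  have 0: "d 0 = d' 0"
    using arg_cong[OF eq, of "\<lambda>n. n mod K"] K by simp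
  then have s: "(\<Sum>t<N. d (Suc t) * K ^ t) = (\<Sum>t<N. d' (Suc t) * K ^ t)" using eq K by simp
  show ?case
  proof (cases t)
    case (Suc t')
    then show ?thesis
      using Suc.IH[of "\<lambda>t. d (Suc t)" "\<lambda>t. d' (Suc t)" t'] s Suc.prems(1,2,4) by simp
  qed (use 0 in simp)
qed simp

lemma digits_unique_on:
  fixes K :: nat and h :: "'a \<Rightarrow> nat"
  assumes A: "finite A" "inj_on h A"
    and d: "\<And>j. j \<in> A \<Longrightarrow> d j < K" "\<And>j. j \<in> A \<Longrightarrow> d' j < K"
    and eq: "(\<Sum>j\<in>A. d j * K ^ h j) = (\<Sum>j\<in>A. d' j * K ^ h j)" and j: "j \<in> A"
  shows "d j = d' j"
proof -
  obtain N where N: "h ` A \<subseteq> {..<N}" using A(1) finite_nat_bounded by blast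
  have K: "K > 0" using d(1)[OF j] by simp
  let ?e = "\<lambda>f t. if t \<in> h ` A then f (inv_into A h t) else 0"
  have conv: "(\<Sum>j\<in>A. f j * K ^ h j) = (\<Sum>t<N. ?e f t * K ^ t)" for f :: "'a \<Rightarrow> nat"
  proof -
    have "(\<Sum>t<N. ?e f t * K ^ t) = (\<Sum>t\<in>h ` A. ?e f t * K ^ t)"
      using N by (intro sum.mono_neutral_right) auto
    also have "\<dots> = (\<Sum>j\<in>A. f j * K ^ h j)"
      using A(2) by (simp add: sum.reindex)
    finally show ?thesis ..
  qed
  have "?e d (h j) = ?e d' (h j)"
  proof (rule digits_unique[where K = K and N = N and d = "?e d" and d' = "?e d'" and t = "h j"])
    show "?e d t < K" "?e d' t < K" for t
      using d K A(2) by (auto simp: inv_into_into)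
    show "(\<Sum>t<N. ?e d t * K ^ t) = (\<Sum>t<N. ?e d' t * K ^ t)"
      using eq unfolding conv .
    show "h j < N" using N j by auto
  qed
  then show ?thesis using A(2) j by simp
qed

context polytree_graph begin

lemma uses_non_edge: "(v, w) \<notin> E \<Longrightarrow> w \<noteq> v \<Longrightarrow> uses x v w = 0"
proof -
  assume a: "(v, w) \<notin> E" "w \<noteq> v"
  have "\<not> (v \<preceq> i \<and> step v i = w)" for i
    using a step_edge(1)[of v i] step_self[of v] by metis
  then show ?thesis by (simp add: uses_def)
qed

lemma uses_self:
  assumes "linked x"
  shows "uses x v v + (\<Sum>w\<in>{w. (v, w) \<in> E}. uses x v w) =
    (if top_of x = v then size x else 0) + (\<Sum>p\<in>{p. (p, v) \<in> E}. uses x p v)"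
proof -
  have "passes x v = (\<Sum>w\<in>insert v {w. (v, w) \<in> E}. uses x v w)"
    unfolding sum_uses[symmetric] by (rule sum.mono_neutral_right) (auto simp: uses_non_edge)
  also have "\<dots> = uses x v v + (\<Sum>w\<in>{w. (v, w) \<in> E}. uses x v w)"
    using edge_not_reaches[of v v] by (subst sum.insert) auto
  finally show ?thesis using passes_conservation[OF assms, of v] by simp
qed

lemma uses_self_mset:
  assumes "admissible M"
  shows "(\<Sum>x\<in>#M. uses x v v) + (\<Sum>w\<in>{w. (v, w) \<in> E}. \<Sum>x\<in>#M. uses x v w) =
    (\<Sum>t\<in>#image_mset (\<lambda>x. (top_of x, size x)) M. if fst t = v then snd t else 0) +
    (\<Sum>p\<in>{p. (p, v) \<in> E}. \<Sum>x\<in>#M. uses x p v)"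
  using assms
proof (induction M)
  case (add x M)
  then have "linked x" "admissible M" by (auto simp: admissible_def)
  then show ?case using uses_self[of x v] add.IH
    by (cases "top_of x = v") (simp_all add: sum.distrib)
qed simp

text \<open>Stopping tokens have no edge coefficient of their own, but their number is what enters a
  vertex minus what leaves it. At other pairs that are not edges all counts vanish.\<close>

lemma same_typeI:
  assumes ad: "admissible M" "admissible N"
    and tops: "image_mset (\<lambda>x. (top_of x, size x)) M = image_mset (\<lambda>x. (top_of x, size x)) N"
    and edges: "\<And>v w. (v, w) \<in> E \<Longrightarrow> (\<Sum>x\<in>#M. uses x v w) = (\<Sum>x\<in>#N. uses x v w)"
  shows "same_type M N"
proof -
  have "(\<Sum>x\<in>#M. uses x v v) = (\<Sum>x\<in>#N. uses x v v)" for v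
    using uses_self_mset[OF ad(1), of v] uses_self_mset[OF ad(2), of v] edges
    unfolding tops by simp
  moreover have "(\<Sum>x\<in>#K. uses x v w) = 0" if "(v, w) \<notin> E" "w \<noteq> v" for K v w
    using uses_non_edge[OF that] by simp
  ultimately have "(\<Sum>x\<in>#M. uses x v w) = (\<Sum>x\<in>#N. uses x v w)" for v w
    using edges by metis
  then show ?thesis using tops by (simp add: same_type_def)
qed

text \<open>The exponent of \<open>X\<close> in the moment of \<open>x\<close> when the moments of
  the tops are set to \<open>X ^ g\<close> and the edge coefficients to
  \<open>X ^ k\<close>.\<close>

definition weight :: "(nat \<times> 'v \<Rightarrow> nat) \<Rightarrow> ('v \<times> 'v \<Rightarrow> nat) \<Rightarrow> 'v multiset \<Rightarrow> nat" where
  "weight g k x = g (size x, top_of x) + (\<Sum>e\<in>E. k e * uses x (fst e) (snd e))"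

lemma sum_weight:
  assumes "\<And>x. x \<in># M \<Longrightarrow> size x \<in> {2, 3}"
  shows "(\<Sum>x\<in>#M. weight g k x) =
    (\<Sum>t\<in>{2, 3} \<times> UNIV. size {#x \<in># M. (size x, top_of x) = t#} * g t) +
    (\<Sum>e\<in>E. (\<Sum>x\<in>#M. uses x (fst e) (snd e)) * k e)"
  using assms
proof (induction M)
  case (add x M)
  let ?n = "\<lambda>M t. size {#x \<in># M. (size x, top_of x) = t#}"
  have "(\<Sum>t\<in>{2, 3} \<times> UNIV. ?n (add_mset x M) t * g t) =
      (\<Sum>t\<in>{2, 3} \<times> UNIV. (if (size x, top_of x) = t then g t else 0) + ?n M t * g t)"
    by (rule sum.cong) auto
  also have "\<dots> = g (size x, top_of x) + (\<Sum>t\<in>{2, 3} \<times> UNIV. ?n M t * g t)"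
    using add.prems[of x] by (simp add: sum.distrib)
  finally show ?case using add by (simp add: weight_def sum.distrib algebra_simps)
qed simp

text \<open>Weights that are powers of a large base read off all exponents of the moment monomials at once.
  The edges receive the higher powers, so that small edge coefficients dominate the variances.\<close>

lemma separating_weights:
  assumes fin: "finite \<M>"
    and M: "\<And>M x. M \<in> \<M> \<Longrightarrow> x \<in># M \<Longrightarrow> linked x \<and> size x \<in> {2, 3}"
  obtains g k where
    "\<And>M N. M \<in> \<M> \<Longrightarrow> N \<in> \<M> \<Longrightarrow>
      (\<Sum>x\<in>#M. weight g k x) = (\<Sum>x\<in>#N. weight g k x) \<Longrightarrow> same_type M N"
    "\<And>t e. t \<in> {2, 3} \<times> UNIV \<Longrightarrow> e \<in> E \<Longrightarrow> 1 \<le> g t \<and> g t \<le> k e"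
proof -
  let ?J = "{2, 3} \<times> UNIV :: (nat \<times> 'v) set"
  obtain h1 :: "nat \<times> 'v \<Rightarrow> nat" and n1 where h1: "h1 ` ?J = {i. i < n1}" "inj_on h1 ?J"
    using finite_imp_inj_to_nat_seg[of ?J] by auto
  obtain h2 :: "'v \<times> 'v \<Rightarrow> nat" and n2 where h2: "h2 ` E = {i. i < n2}" "inj_on h2 E"
    using finite_imp_inj_to_nat_seg[of E] by auto
  \<comment> \<open>The digits are the exponents of the parametrised monomial. Pairs of size and top
    occupy the first \<open>n1\<close> positions, and the edges the positions after them.\<close>
  let ?d = "\<lambda>M. case_sum (\<lambda>t. size {#x \<in># M. (size x, top_of x) = t#})
      (\<lambda>e. \<Sum>x\<in>#M. uses x (fst e) (snd e))"
  let ?A = "?J <+> E"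
  let ?h = "case_sum h1 (\<lambda>e. n1 + h2 e)"
  have finA: "finite ?A" by simp
  have inj: "inj_on ?h ?A"
  proof -
    have "h1 t < n1" if "t \<in> ?J" for t using h1(1) that by blast
    then have lt: "h1 t \<noteq> n1 + e" if "t \<in> ?J" for t e using that by (metis not_add_less1)
    show ?thesis
    proof (rule inj_onI)
      fix a b assume ab: "a \<in> ?A" "b \<in> ?A" "?h a = ?h b"
      show "a = b"
      proof (cases a; cases b)
        fix t t' assume "a = Inl t" "b = Inl t'"
        then show ?thesis using ab inj_onD[OF h1(2), of t t'] by auto
      next
        fix e e' assume "a = Inr e" "b = Inr e'"
        then show ?thesis using ab inj_onD[OF h2(2), of e e'] by auto
      next
        fix t e assume *: "a = Inl t" "b = Inr e"
        then have "t \<in> ?J" using ab(1) by blast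
        then show ?thesis using ab(3) lt[of t "h2 e"] * by simp
      next
        fix t e assume *: "a = Inr e" "b = Inl t"
        then have "t \<in> ?J" using ab(2) by blast
        then show ?thesis using ab(3) lt[of t "h2 e"] * by simp
      qed
    qed
  qed
  have "finite ((\<lambda>(M, j). ?d M j) ` (\<M> \<times> ?A))" using fin finA by blast
  then obtain K0 where K0: "(\<lambda>(M, j). ?d M j) ` (\<M> \<times> ?A) \<subseteq> {..<K0}"
    using finite_nat_bounded by blast
  \<comment> \<open>A base above all digits that occur in the finite set of monomials;
    \<open>Suc\<close> keeps it positive, so that its powers are at least 1 and monotone.\<close>
  define K where "K = Suc K0"
  have dK: "?d M j < K" if "M \<in> \<M>" "j \<in> ?A" for M j
    using K0 that unfolding K_def by (fastforce simp: less_Suc_eq)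
  define g where "g t = K ^ h1 t" for t
  define k where "k e = K ^ (n1 + h2 e)" for e
  have wt: "(\<Sum>x\<in>#M. weight g k x) = (\<Sum>j\<in>?A. ?d M j * K ^ ?h j)" if "M \<in> \<M>" for M
    using M[OF that] by (subst sum_weight) (auto simp: sum.Plus g_def k_def)
  show ?thesis
  proof (rule that)
    fix M N assume MN: "M \<in> \<M>" "N \<in> \<M>" "(\<Sum>x\<in>#M. weight g k x) = (\<Sum>x\<in>#N. weight g k x)"
    have d: "?d M j = ?d N j" if "j \<in> ?A" for j
      by (rule digits_unique_on[OF finA inj, of _ K])
        (use dK MN wt that in auto)
    have ad: "admissible M" "admissible N"
      using M MN unfolding admissible_def by fastforce+
    have sz: "size {#x \<in># P. (size x, top_of x) = (n, u)#} =
        count (image_mset (\<lambda>x. (top_of x, size x)) P) (u, n)" for P n u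
      by (induction P) auto
    have tops: "image_mset (\<lambda>x. (top_of x, size x)) M = image_mset (\<lambda>x. (top_of x, size x)) N"
    proof (rule multiset_eqI, clarify)
      fix u :: 'v and n :: nat
      show "count (image_mset (\<lambda>x. (top_of x, size x)) M) (u, n) =
          count (image_mset (\<lambda>x. (top_of x, size x)) N) (u, n)"
      proof (cases "n \<in> {2, 3}")
        case True
        then show ?thesis using d[of "Inl (n, u)"] unfolding sz[symmetric] by auto
      next
        case False
        have z: "{#x \<in># P. (size x, top_of x) = (n, u)#} = {#}" if "P \<in> \<M>" for P
          using M[OF that] False by (auto simp: filter_mset_eq_conv)
        show ?thesis unfolding sz[symmetric] z[OF MN(1)] z[OF MN(2)] ..
      qed
    qed
    show "same_type M N"
      by (rule same_typeI[OF ad tops]) (use d[of "Inr _"] in force)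
  next
    fix t :: "nat \<times> 'v" and e assume t: "t \<in> ?J" "e \<in> E"
    then have "h1 t < n1" using h1(1) by blast
    then show "1 \<le> g t \<and> g t \<le> k e"
      unfolding g_def k_def K_def by (auto intro!: power_increasing)
  qed
qed

text \<open>A point of the curve with parameter \<open>X\<close>. What has to be checked is
  \<open>W 2 u > 0\<close>: as \<open>k\<close> dominates \<open>g\<close>, each parent of
  \<open>u\<close> takes away at most the fraction \<open>X\<close> of \<open>c 2 u\<close>, and the
  number of parents times \<open>X\<close> is below 1.\<close>

lemma realize_weights:
  fixes X :: real
  assumes gk: "\<And>t e. t \<in> {2, 3} \<times> UNIV \<Longrightarrow> e \<in> E \<Longrightarrow> 1 \<le> g t \<and> g t \<le> k e"
    and X: "0 < X" "X < 1" "real CARD('v) * X < 1"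
  obtains S T D where "(S, T) \<in> moment_model E"
    "\<And>i j. S $ i $ j = D {#i, j#}" "\<And>i j l. T $ i $ j $ l = D {#i, j, l#}"
    "\<And>x. size x \<in> {2, 3} \<Longrightarrow> D x = (if linked x then X ^ weight g k x else 0)"
proof -
  define L :: "real^'v^'v" where "L = (\<chi> v w. if (v, w) \<in> E then X ^ k (v, w) else 0)"
  have L: "L \<in> edge_matrices E" by (simp add: L_def edge_matrices_def)
  define c where "c n u = X ^ g (n, u)" for n u
  define W where "W = (\<lambda>n u. c n u - (\<Sum>p\<in>{p. (p, u) \<in> E}. L $ p $ u ^ n * c n p))"
  define D where "D = diag_moment W (matrix_inv (mat 1 - L))"
  have W2: "W 2 u > 0" for u
  proof -
    have "(\<Sum>p\<in>{p. (p, u) \<in> E}. L $ p $ u ^ 2 * c 2 p) \<le> (\<Sum>p\<in>{p. (p, u) \<in> E}. X * c 2 u)"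
    proof (rule sum_mono)
      fix p assume "p \<in> {p. (p, u) \<in> E}"
      then have e: "(p, u) \<in> E" by simp
      have "L $ p $ u ^ 2 * c 2 p = X ^ (k (p, u) * 2 + g (2, p))"
        using e by (simp add: L_def c_def power_add power_mult)
      also have "\<dots> \<le> X ^ (1 + g (2, u))"
        using X gk[of "(2, u)" "(p, u)"] gk[of "(2, p)" "(p, u)"] e by (intro power_decreasing) auto
      finally show "L $ p $ u ^ 2 * c 2 p \<le> X * c 2 u" by (simp add: c_def)
    qed
    also have "\<dots> = real (card {p. (p, u) \<in> E}) * X * c 2 u" by simp
    also have "\<dots> \<le> real CARD('v) * X * c 2 u"
      using X by (intro mult_right_mono) (auto simp: c_def card_mono)
    also have "\<dots> < 1 * c 2 u" using X by (intro mult_strict_right_mono) (auto simp: c_def)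
    finally show ?thesis by (simp add: W_def)
  qed
  have D: "D x = (if linked x then X ^ weight g k x else 0)" if "size x \<in> {2, 3}" for x
  proof (cases "linked x")
    case True
    have "D x = c (size x) (top_of x) * (\<Prod>(v, w)\<in>E. L $ v $ w ^ uses x v w)"
      unfolding D_def diag_moment_linked[OF L True refl] path_weight_prod_uses[OF L True]
      using that diag_moment_replicate[OF L, of "size x" c "top_of x"] unfolding W_def by auto
    also have "(\<Prod>(v, w)\<in>E. L $ v $ w ^ uses x v w) = (\<Prod>e\<in>E. X ^ (k e * uses x (fst e) (snd e)))"
      by (rule prod.cong) (auto simp: L_def power_mult)
    finally show ?thesis using True by (simp add: c_def weight_def power_add power_sum)
  next
    case False
    moreover have "x \<noteq> {#}" using that by auto
    ultimately show ?thesis using diag_moment_not_linked[OF L False] by (simp add: D_def)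
  qed
  show ?thesis
    by (rule that[OF diag_moment_in_model[where W = W, OF L W2]]) (use D in \<open>simp_all add: D_def\<close>)
qed

end

section \<open>Polynomial evaluation and ideals\<close>

definition eval_mono :: "('x \<Rightarrow> complex) \<Rightarrow> ('x \<Rightarrow>\<^sub>0 nat) \<Rightarrow> complex" where
  "eval_mono f m = (\<Prod>x\<in>Poly_Mapping.keys m. f x ^ Poly_Mapping.lookup m x)"

lemma eval_mono_superset:
  assumes "finite A" "Poly_Mapping.keys m \<subseteq> A"
  shows "eval_mono f m = (\<Prod>x\<in>A. f x ^ Poly_Mapping.lookup m x)"
  unfolding eval_mono_def using assms
  by (intro prod.mono_neutral_left) (auto simp: in_keys_iff)

lemma eval_mono_add: "eval_mono f (a + b) = eval_mono f a * eval_mono f b"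
proof -
  let ?A = "Poly_Mapping.keys a \<union> Poly_Mapping.keys b"
  have "eval_mono f (a + b) = (\<Prod>x\<in>?A. f x ^ Poly_Mapping.lookup (a + b) x)"
    by (rule eval_mono_superset) (simp_all add: Poly_Mapping.keys_add)
  also have "\<dots> = eval_mono f a * eval_mono f b"
    using eval_mono_superset[of ?A a f] eval_mono_superset[of ?A b f]
    by (simp add: lookup_add power_add prod.distrib)
  finally show ?thesis .
qed

lemma eval_cpoly_superset:
  assumes "finite A" "Poly_Mapping.keys p \<subseteq> A"
  shows "eval_cpoly f p = (\<Sum>m\<in>A. Poly_Mapping.lookup p m * eval_mono f m)"
  unfolding eval_cpoly_def eval_mono_def[symmetric] using assms
  by (intro sum.mono_neutral_left) (auto simp: in_keys_iff)

lemma eval_cpoly_add: "eval_cpoly f (p + q) = eval_cpoly f p + eval_cpoly f q"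
proof -
  let ?A = "Poly_Mapping.keys p \<union> Poly_Mapping.keys q"
  have "eval_cpoly f (p + q) = (\<Sum>m\<in>?A. Poly_Mapping.lookup (p + q) m * eval_mono f m)"
    by (rule eval_cpoly_superset) (simp_all add: Poly_Mapping.keys_add)
  also have "\<dots> = eval_cpoly f p + eval_cpoly f q"
    using eval_cpoly_superset[of ?A p f] eval_cpoly_superset[of ?A q f]
    by (simp add: lookup_add distrib_right sum.distrib)
  finally show ?thesis .
qed

lemma eval_cpoly_zero [simp]: "eval_cpoly f 0 = 0"
  by (simp add: eval_cpoly_def)

lemma eval_cpoly_single [simp]: "eval_cpoly f (Poly_Mapping.single m c) = c * eval_mono f m"
  using eval_cpoly_superset[of "{m}" "Poly_Mapping.single m c" f] by (simp split: if_splits)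

lemma eval_cpoly_one [simp]: "eval_cpoly f 1 = 1"
  using eval_cpoly_single[of f 0 1] by (simp add: eval_mono_def)

lemma eval_cpoly_sum: "eval_cpoly f (sum g A) = (\<Sum>a\<in>A. eval_cpoly f (g a))"
  by (induction A rule: infinite_finite_induct) (simp_all add: eval_cpoly_add)

lemma eval_cpoly_uminus: "eval_cpoly f (- p) = - eval_cpoly f p"
  using eval_cpoly_add[of f p "- p"] by (simp add: eq_neg_iff_add_eq_0 add.commute)

lemma eval_cpoly_diff: "eval_cpoly f (p - q) = eval_cpoly f p - eval_cpoly f q"
  using eval_cpoly_add[of f p "- q"] by (simp add: eval_cpoly_uminus)

lemma single_sum: "Poly_Mapping.single k (sum c A) = (\<Sum>a\<in>A. Poly_Mapping.single k (c a))"
  by (induction A rule: infinite_finite_induct) (simp_all add: single_add)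

lemma sum_singles:
  "(\<Sum>m\<in>Poly_Mapping.keys p. Poly_Mapping.single m (Poly_Mapping.lookup p m)) = p"
proof (rule poly_mapping_eqI)
  fix k
  have "Poly_Mapping.lookup (\<Sum>m\<in>Poly_Mapping.keys p. Poly_Mapping.single m (Poly_Mapping.lookup p m)) k =
      (\<Sum>m\<in>Poly_Mapping.keys p. if m = k then Poly_Mapping.lookup p m else 0)"
    by (simp add: lookup_sum lookup_single when_def)
  then show "Poly_Mapping.lookup (\<Sum>m\<in>Poly_Mapping.keys p. Poly_Mapping.single m (Poly_Mapping.lookup p m)) k =
      Poly_Mapping.lookup p k"
    by (simp add: in_keys_iff)
qed

lemma eval_cpoly_mult: "eval_cpoly f (p * q) = eval_cpoly f p * eval_cpoly f q"
proof -
  let ?c = Poly_Mapping.lookup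
  have "p * q = (\<Sum>a\<in>Poly_Mapping.keys p. Poly_Mapping.single a (?c p a)) *
      (\<Sum>b\<in>Poly_Mapping.keys q. Poly_Mapping.single b (?c q b))"
    by (simp add: sum_singles)
  also have "\<dots> = (\<Sum>a\<in>Poly_Mapping.keys p. \<Sum>b\<in>Poly_Mapping.keys q.
      Poly_Mapping.single (a + b) (?c p a * ?c q b))"
    by (simp add: sum_product mult_single)
  finally have "eval_cpoly f (p * q) = (\<Sum>a\<in>Poly_Mapping.keys p. \<Sum>b\<in>Poly_Mapping.keys q.
      (?c p a * eval_mono f a) * (?c q b * eval_mono f b))"
    by (simp add: eval_cpoly_sum eval_mono_add ac_simps)
  also have "\<dots> = eval_cpoly f p * eval_cpoly f q"
    using eval_cpoly_superset[of "Poly_Mapping.keys p" p f] eval_cpoly_superset[of "Poly_Mapping.keys q" q f]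
    by (simp add: sum_product)
  finally show ?thesis .
qed

lemma eval_cpoly_indet [simp]: "eval_cpoly f (indet x) = f x"
  by (simp add: indet_def eval_mono_def)

lemma eval_cpoly_prod_mset: "eval_cpoly f (\<Prod>x\<in>#M. g x) = (\<Prod>x\<in>#M. eval_cpoly f (g x))"
  by (induction M) (simp_all add: eval_cpoly_mult)

lemma cpoly_ring_simps [simp]:
  "x \<otimes>\<^bsub>cpoly_ring X\<^esub> y = x * y" "x \<oplus>\<^bsub>cpoly_ring X\<^esub> y = x + y"
  "\<one>\<^bsub>cpoly_ring X\<^esub> = 1" "\<zero>\<^bsub>cpoly_ring X\<^esub> = 0"
  by (simp_all add: cpoly_ring_def)

lemma single_in_cpoly_ring: "Poly_Mapping.keys m \<subseteq> X \<Longrightarrow> Poly_Mapping.single m c \<in> carrier (cpoly_ring X)"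
  by (auto simp: cpoly_ring_def split: if_splits)

lemma indet_in_cpoly_ring: "x \<in> X \<Longrightarrow> indet x \<in> carrier (cpoly_ring X)"
  unfolding indet_def by (rule single_in_cpoly_ring) (simp split: if_splits)

lemma cpoly_ring_mult: "p \<in> carrier (cpoly_ring X) \<Longrightarrow> q \<in> carrier (cpoly_ring X) \<Longrightarrow> p * q \<in> carrier (cpoly_ring X)"
  using cring.cring_simprules(5)[OF cring_cpoly_ring, of p X q] by simp

lemma cpoly_ring_add: "p \<in> carrier (cpoly_ring X) \<Longrightarrow> q \<in> carrier (cpoly_ring X) \<Longrightarrow> p + q \<in> carrier (cpoly_ring X)"
  using cring.cring_simprules(1)[OF cring_cpoly_ring, of p X q] by simp

lemma cpoly_ring_uminus: "p \<in> carrier (cpoly_ring X) \<Longrightarrow> - p \<in> carrier (cpoly_ring X)"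
  by (simp add: cpoly_ring_def)

lemma cpoly_ring_diff: "p \<in> carrier (cpoly_ring X) \<Longrightarrow> q \<in> carrier (cpoly_ring X) \<Longrightarrow> p - q \<in> carrier (cpoly_ring X)"
  using cpoly_ring_add[of p X "- q"] cpoly_ring_uminus[of q X] by simp

lemma cpoly_ring_prod_mset:
  "(\<And>x. x \<in># M \<Longrightarrow> g x \<in> carrier (cpoly_ring X)) \<Longrightarrow> (\<Prod>x\<in>#M. g x) \<in> carrier (cpoly_ring X)"
proof (induction M)
  case empty
  have "Poly_Mapping.single 0 1 \<in> carrier (cpoly_ring X)" by (rule single_in_cpoly_ring) simp
  then show ?case by simp
qed (simp add: cpoly_ring_mult)

section \<open>Ideals of the polynomial ring and congruence modulo them\<close>

context
  fixes I :: "'x cpoly set" and X :: "'x set"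
  assumes I: "ideal I (cpoly_ring X)"
begin

lemma cpoly_ideal_add: "p \<in> I \<Longrightarrow> q \<in> I \<Longrightarrow> p + q \<in> I"
  using additive_subgroup.a_closed[OF ideal.axioms(1)[OF I], of p q] by simp

lemma cpoly_ideal_zero: "0 \<in> I"
  using additive_subgroup.zero_closed[OF ideal.axioms(1)[OF I]] by simp

lemma cpoly_ideal_mult: "p \<in> I \<Longrightarrow> r \<in> carrier (cpoly_ring X) \<Longrightarrow> r * p \<in> I"
  using ideal.I_l_closed[OF I, of p r] by simp

lemma cpoly_ideal_sum: "(\<And>a. a \<in> A \<Longrightarrow> f a \<in> I) \<Longrightarrow> sum f A \<in> I"
  by (induction A rule: infinite_finite_induct) (simp_all add: cpoly_ideal_zero cpoly_ideal_add)

text \<open>If the coefficients sum to zero over each class of pairwise congruent terms, then the linear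
  combination is congruent to zero: subtract one representative from each class.\<close>

lemma cpoly_ideal_sum_classes:
  assumes fin: "finite A"
    and P: "\<And>a b. a \<in> A \<Longrightarrow> b \<in> A \<Longrightarrow> w a = w b \<Longrightarrow> P a - P b \<in> I"
    and c: "\<And>n. (\<Sum>a\<in>{a \<in> A. w a = n}. c a) = 0"
  shows "(\<Sum>a\<in>A. Poly_Mapping.single 0 (c a) * P a) \<in> I"
proof -
  define rep where "rep n = (SOME b. b \<in> A \<and> w b = n)" for n
  have rep: "rep (w a) \<in> A \<and> w (rep (w a)) = w a" if "a \<in> A" for a
    unfolding rep_def using that by (intro someI[of "\<lambda>b. b \<in> A \<and> w b = w a" a]) simp
  have cls: "(\<Sum>a\<in>{a \<in> A. w a = n}. Poly_Mapping.single 0 (c a) * P (rep (w a))) = 0" for n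
  proof -
    have "(\<Sum>a\<in>{a \<in> A. w a = n}. Poly_Mapping.single 0 (c a) * P (rep (w a))) =
        (\<Sum>a\<in>{a \<in> A. w a = n}. Poly_Mapping.single 0 (c a)) * P (rep n)"
      by (simp add: sum_distrib_right)
    also have "(\<Sum>a\<in>{a \<in> A. w a = n}. Poly_Mapping.single 0 (c a)) =
        (Poly_Mapping.single 0 (\<Sum>a\<in>{a \<in> A. w a = n}. c a) :: 'x cpoly)"
      by (simp add: single_sum)
    finally show ?thesis by (simp add: c)
  qed
  have "(\<Sum>a\<in>A. Poly_Mapping.single 0 (c a) * P (rep (w a))) =
      (\<Sum>n\<in>w ` A. \<Sum>a\<in>{a \<in> A. w a = n}. Poly_Mapping.single 0 (c a) * P (rep (w a)))"
    using fin by (rule sum.image_gen)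
  also have "\<dots> = 0" using cls by simp
  finally have z: "(\<Sum>a\<in>A. Poly_Mapping.single 0 (c a) * P (rep (w a))) = 0" .
  have "(\<Sum>a\<in>A. Poly_Mapping.single 0 (c a) * (P a - P (rep (w a)))) \<in> I"
    using rep P by (intro cpoly_ideal_sum cpoly_ideal_mult single_in_cpoly_ring) auto
  then show ?thesis using z by (simp add: right_diff_distrib sum_subtractf)
qed

end

lemma monomial_as_prod:
  "\<exists>N. set_mset N = Poly_Mapping.keys m \<and> Poly_Mapping.single m (1::complex) = (\<Prod>y\<in>#N. indet y)"
proof (induction "\<Sum>x\<in>Poly_Mapping.keys m. Poly_Mapping.lookup m x" arbitrary: m rule: less_induct)
  case less
  show ?case
  proof (cases "m = 0")
    case False
    then obtain x where x: "x \<in> Poly_Mapping.keys m" by fastforce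
    let ?m = "m - Poly_Mapping.single x 1"
    have m: "m = ?m + Poly_Mapping.single x 1"
      using x by (intro poly_mapping_eqI)
        (auto simp: lookup_add lookup_minus lookup_single when_def in_keys_iff)
    have keys: "Poly_Mapping.keys m = insert x (Poly_Mapping.keys ?m)"
      using x by (auto simp: in_keys_iff lookup_minus lookup_single when_def split: if_splits)
    have "(\<Sum>y\<in>Poly_Mapping.keys ?m. Poly_Mapping.lookup ?m y) = (\<Sum>y\<in>Poly_Mapping.keys m. Poly_Mapping.lookup ?m y)"
      using keys by (intro sum.mono_neutral_left) (auto simp: in_keys_iff)
    also have "\<dots> < (\<Sum>y\<in>Poly_Mapping.keys m. Poly_Mapping.lookup m y)"
      using x by (intro sum_strict_mono_ex1)
        (auto simp: lookup_minus lookup_single in_keys_iff intro!: bexI[of _ x])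
    finally obtain N where N: "set_mset N = Poly_Mapping.keys ?m"
      "Poly_Mapping.single ?m (1::complex) = (\<Prod>y\<in>#N. indet y)"
      using less by blast
    have "Poly_Mapping.single m (1::complex) = Poly_Mapping.single ?m 1 * indet x"
      by (subst m) (simp add: indet_def mult_single)
    then show ?thesis using N keys by (intro exI[of _ "add_mset x N"]) (simp add: mult.commute)
  qed (auto intro: exI[of _ "{#}"])
qed

section \<open>Moment indeterminates indexed by multisets of two or three vertices\<close>

definition mset_var :: "'v::linorder multiset \<Rightarrow> 'v moment_var" where
  "mset_var x = (case sorted_list_of_multiset x of
     [i, j] \<Rightarrow> S_var i j | [i, j, k] \<Rightarrow> T_var i j k | _ \<Rightarrow> undefined)"

definition mset_poly :: "'v::linorder multiset \<Rightarrow> 'v moment_var cpoly" where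
  "mset_poly x = indet (mset_var x)"

lemma s_poly_eq: "s_poly i j = mset_poly {#i, j#}"
proof -
  have "sorted_list_of_multiset {#i, j#} = sort [i, j]"
    using sorted_list_of_multiset_mset[of "[i, j]"] by (simp only: mset.simps)
  then show ?thesis by (simp add: s_poly_def mset_poly_def mset_var_def)
qed

lemma t_poly_eq: "t_poly i j k = mset_poly {#i, j, k#}"
proof -
  have "sorted_list_of_multiset {#i, j, k#} = sort [i, j, k]"
    using sorted_list_of_multiset_mset[of "[i, j, k]"] by (simp only: mset.simps)
  then show ?thesis by (simp add: t_poly_def mset_poly_def mset_var_def)
qed

lemma sorted_mset_cases:
  fixes x :: "'v::linorder multiset"
  assumes "size x \<in> {2, 3}"
  obtains i j where "i \<le> j" "x = {#i, j#}" "mset_var x = S_var i j"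
  | i j k where "i \<le> j" "j \<le> k" "x = {#i, j, k#}" "mset_var x = T_var i j k"
proof -
  let ?l = "sorted_list_of_multiset x"
  have l: "mset ?l = x" "sorted ?l" by simp_all
  then have "length ?l = 2 \<or> length ?l = 3" using assms by (metis insert_iff singletonD size_mset)
  then consider i j where "?l = [i, j]" | i j k where "?l = [i, j, k]"
    by (auto simp: numeral_2_eq_2 numeral_3_eq_3 length_Suc_conv)
  then show ?thesis
  proof cases
    case (1 i j)
    then show ?thesis using l by (intro that(1)[of i j]) (auto simp: mset_var_def)
  next
    case (2 i j k)
    then show ?thesis using l by (intro that(2)[of i j k]) (auto simp: mset_var_def)
  qed
qed

lemma mset_var_in_moment_vars:
  assumes "size x \<in> {2, 3}" "set_mset x \<subseteq> A" shows "mset_var x \<in> moment_vars A"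
  using assms(1)
proof (cases rule: sorted_mset_cases)
  case (1 i j)
  then show ?thesis using assms(2) by (auto simp: moment_vars_def)
next
  case (2 i j k)
  then show ?thesis using assms(2) by (auto simp: moment_vars_def)
qed

lemma moment_vars_cases:
  assumes "y \<in> moment_vars A"
  shows "\<exists>x. size x \<in> {2, 3} \<and> set_mset x \<subseteq> A \<and> mset_var x = y"
proof -
  from assms consider i j where "y = S_var i j" "i \<in> A" "j \<in> A" "i \<le> j"
    | i j k where "y = T_var i j k" "i \<in> A" "j \<in> A" "k \<in> A" "i \<le> j" "j \<le> k"
    unfolding moment_vars_def by blast
  then show ?thesis
  proof cases
    case (1 i j)
    then have "sorted_list_of_multiset {#i, j#} = [i, j]"
      using sorted_list_of_multiset_mset[of "[i, j]"] by simp
    then show ?thesis using 1 by (intro exI[of _ "{#i, j#}"]) (simp add: mset_var_def)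
  next
    case (2 i j k)
    then have "sorted_list_of_multiset {#i, j, k#} = [i, j, k]"
      using sorted_list_of_multiset_mset[of "[i, j, k]"] by simp
    then show ?thesis using 2 by (intro exI[of _ "{#i, j, k#}"]) (simp add: mset_var_def)
  qed
qed

lemma mset_poly_in_moment_ring:
  "size x \<in> {2, 3} \<Longrightarrow> set_mset x \<subseteq> A \<Longrightarrow> mset_poly x \<in> carrier (moment_ring A)"
  unfolding mset_poly_def by (intro indet_in_cpoly_ring mset_var_in_moment_vars)

lemma eval_mset_poly:
  assumes "\<And>i j. S $ i $ j = D {#i, j#}" "\<And>i j k. T $ i $ j $ k = D {#i, j, k#}" "size x \<in> {2, 3}"
  shows "eval_cpoly (moment_value S T) (mset_poly x) = complex_of_real (D x)"
  using assms(3) by (cases rule: sorted_mset_cases) (simp_all add: mset_poly_def assms(1,2))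

section \<open>The toric ideal\<close>

fun col_mset :: "'v trek_column \<Rightarrow> 'v multiset" where
  "col_mset (S_col k) = {#k#}"
| "col_mset (T_col l m) = {#l, m#}"

lemma set_col_mset: "set_mset (col_mset c) = set_trek_column c"
  by (cases c) auto

lemma size_col_mset: "size (add_mset i (col_mset c)) \<in> {2, 3}"
  by (cases c) auto

lemma trek_matrix_entry_eq: "trek_matrix_entry i c = mset_poly (add_mset i (col_mset c))"
  by (cases c) (simp_all add: s_poly_eq t_poly_eq)

lemma col_mset_exists:
  fixes A :: "'v::linorder multiset"
  assumes "size A \<in> {1, 2}"
  shows "\<exists>c. col_mset c = A \<and> (\<forall>l m. c = T_col l m \<longrightarrow> l \<le> m)"
proof -
  consider k where "A = {#k#}" | l m where "A = {#l, m#}" "l \<le> m"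
  proof -
    from assms consider "size A = Suc 0" | "size A = Suc (Suc 0)" by auto
    then show ?thesis
    proof cases
      case 1
      then show ?thesis using that(1) size_1_singleton_mset by auto
    next
      case 2
      from size_eq_Suc_imp_eq_union[OF this] obtain l N where N: "A = add_mset l N" by blast
      then have "size N = 1" using 2 by simp
      from size_1_singleton_mset[OF this] obtain m where "N = {#m#}" by blast
      then show ?thesis using N that(2)[of l m] that(2)[of m l]
        by (cases "l \<le> m") (auto simp: add_mset_commute)
    qed
  qed
  then show ?thesis
  proof cases
    case 1
    then show ?thesis by (intro exI[of _ "S_col k"]) simp
  next
    case 2
    then show ?thesis by (intro exI[of _ "T_col l m"]) simp
  qed
qed

definition mset_monomial :: "'v::linorder multiset multiset \<Rightarrow> 'v moment_var cpoly" where
  "mset_monomial M = (\<Prod>x\<in>#M. mset_poly x)"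

definition observable :: "'v set \<Rightarrow> 'v multiset multiset \<Rightarrow> bool" where
  "observable A M \<longleftrightarrow> (\<forall>x\<in>#M. size x \<in> {2, 3} \<and> set_mset x \<subseteq> A)"

lemma mset_monomial_in_moment_ring:
  "observable A M \<Longrightarrow> mset_monomial M \<in> carrier (moment_ring A)"
  unfolding mset_monomial_def observable_def
  by (intro cpoly_ring_prod_mset mset_poly_in_moment_ring) auto

lemma single_as_mset_monomial:
  assumes "Poly_Mapping.keys m \<subseteq> moment_vars A"
  shows "\<exists>M. observable A M \<and> Poly_Mapping.single m 1 = mset_monomial M"
proof -
  from monomial_as_prod[of m]
  obtain N where N: "set_mset N = Poly_Mapping.keys m" "Poly_Mapping.single m (1::complex) = (\<Prod>y\<in>#N. indet y)"
    by (elim exE conjE)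
  have "\<forall>y\<in>moment_vars A. \<exists>x. size x \<in> {2, 3} \<and> set_mset x \<subseteq> A \<and> mset_var x = y"
    by (rule ballI) (rule moment_vars_cases)
  from bchoice[OF this] obtain f where
    f: "\<forall>y\<in>moment_vars A. size (f y) \<in> {2, 3} \<and> set_mset (f y) \<subseteq> A \<and> mset_var (f y) = y"
    by (rule exE)
  have f': "size (f y) \<in> {2, 3} \<and> set_mset (f y) \<subseteq> A" "mset_var (f y) = y" if "y \<in># N" for y
  proof -
    have "y \<in> moment_vars A" using that N(1) assms by auto
    from bspec[OF f this] show "size (f y) \<in> {2, 3} \<and> set_mset (f y) \<subseteq> A" "mset_var (f y) = y"
      by simp_all
  qed
  have "observable A (image_mset f N)"
    unfolding observable_def using f'(1) by simp
  moreover have "image_mset (\<lambda>y. mset_poly (f y)) N = image_mset indet N"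
    by (intro image_mset_cong) (simp add: mset_poly_def f'(2))
  then have "Poly_Mapping.single m 1 = mset_monomial (image_mset f N)"
    unfolding N(2) mset_monomial_def by (simp add: image_mset.compositionality comp_def)
  ultimately show ?thesis by blast
qed

lemma observed_ideal_eq:
  "observed_ideal E A = {p \<in> carrier (moment_ring A).
    \<forall>S T. (S, T) \<in> moment_model E \<longrightarrow> eval_cpoly (moment_value S T) p = 0}"
proof -
  have "moment_vars A \<subseteq> moment_vars UNIV" by (auto simp: moment_vars_def)
  then have "carrier (moment_ring A) \<subseteq> carrier (moment_ring UNIV)"
    by (auto simp: cpoly_ring_def)
  then show ?thesis unfolding observed_ideal_def moment_ideal_def by blast
qed

lemma ideal_observed_ideal: "ideal (observed_ideal E A) (moment_ring A)"
proof -
  let ?R = "moment_ring A"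
  interpret R: cring ?R by (rule cring_cpoly_ring)
  have inv: "\<ominus>\<^bsub>?R\<^esub> p = - p" if "p \<in> carrier ?R" for p
    using that cpoly_ring_uminus[of p] by (intro R.minus_equality) simp_all
  have zero: "0 \<in> carrier ?R" using R.zero_closed by simp
  show ?thesis
  proof (rule idealI)
    show "ring ?R" by (rule R.ring_axioms)
    show "subgroup (observed_ideal E A) (add_monoid ?R)"
    proof (rule subgroup.intro)
      show "inv\<^bsub>add_monoid ?R\<^esub> p \<in> observed_ideal E A" if "p \<in> observed_ideal E A" for p
        using that inv[of p] cpoly_ring_uminus[of p]
        by (auto simp: observed_ideal_eq a_inv_def eval_cpoly_uminus)
    qed (auto simp: observed_ideal_eq cpoly_ring_add eval_cpoly_add zero)
  qed (auto simp: observed_ideal_eq cpoly_ring_mult eval_cpoly_mult)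
qed

text \<open>The vanishing sum is a univariate polynomial in \<open>X\<close> with infinitely many
  roots, and the claimed sum is its coefficient at exponent \<open>n\<close>.\<close>

lemma zero_of_infinitely_many_zeros:
  fixes c :: "'a \<Rightarrow> complex" and w :: "'a \<Rightarrow> nat"
  assumes fin: "finite A" and inf: "infinite Z"
    and z: "\<And>X. X \<in> Z \<Longrightarrow> (\<Sum>a\<in>A. c a * X ^ w a) = 0"
  shows "(\<Sum>a\<in>{a \<in> A. w a = n}. c a) = 0"
proof -
  let ?p = "\<Sum>a\<in>A. monom (c a) (w a)"
  have "poly ?p X = 0" if "X \<in> Z" for X
    using z[OF that] by (simp add: poly_sum poly_monom)
  then have "Z \<subseteq> {X. poly ?p X = 0}" by blast
  then have "?p = 0" using inf poly_roots_finite[of ?p] finite_subset by blast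
  then have "coeff ?p n = 0" by simp
  then show ?thesis using fin by (simp add: coeff_sum sum.If_cases Int_def)
qed

section \<open>The observed ideal and the ideal of the trek generators\<close>

locale ordered_polytree = polytree_graph E for E :: "'v::{finite,linorder} rel" +
  fixes Obs :: "'v set"
begin

abbreviation trek_generators :: "'v moment_var cpoly set" where
  "trek_generators \<equiv> observed_trek_minors E Obs \<union> observed_trekless_moments E Obs"

abbreviation trek_ideal :: "'v moment_var cpoly set" where
  "trek_ideal \<equiv> Idl\<^bsub>moment_ring Obs\<^esub> trek_generators"

lemma trek_matrix_columns_iff:
  "c \<in> trek_matrix_columns E i j \<longleftrightarrow> (\<forall>l m. c = T_col l m \<longrightarrow> l \<le> m) \<and>
    linked (add_mset i (col_mset c)) \<and> linked (add_mset j (col_mset c)) \<and>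
    top_of (add_mset i (col_mset c)) = top_of (add_mset j (col_mset c))"
  by (cases c) (auto simp: trek_matrix_columns_def same_top_iff)

lemma trekless_generators:
  "observed_trekless_moments E Obs = mset_poly ` {x. size x \<in> {2, 3} \<and> set_mset x \<subseteq> Obs \<and> \<not> linked x}"
    (is "_ = mset_poly ` ?B")
proof
  show "observed_trekless_moments E Obs \<subseteq> mset_poly ` ?B"
    by (auto simp: observed_trekless_moments_def s_poly_eq t_poly_eq trek_exists_iff_linked)
  show "mset_poly ` ?B \<subseteq> observed_trekless_moments E Obs"
  proof clarify
    fix x assume x: "size x \<in> {2, 3}" "set_mset x \<subseteq> Obs" "\<not> linked x"
    from x(1) show "mset_poly x \<in> observed_trekless_moments E Obs"
    proof (cases rule: sorted_mset_cases)
      case (1 i j)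
      then have "mset_poly x = s_poly i j" "\<not> trek_exists E [i, j]" "i \<in> Obs" "j \<in> Obs"
        using x by (auto simp: s_poly_eq trek_exists_iff_linked)
      then show ?thesis unfolding observed_trekless_moments_def by blast
    next
      case (2 i j k)
      then have "mset_poly x = t_poly i j k" "\<not> trek_exists E [i, j, k]" "i \<in> Obs" "j \<in> Obs" "k \<in> Obs"
        using x by (auto simp: t_poly_eq trek_exists_iff_linked)
      then show ?thesis unfolding observed_trekless_moments_def by blast
    qed
  qed
qed

lemma trek_generators_in_ring: "trek_generators \<subseteq> carrier (moment_ring Obs)"
proof -
  have "observed_trek_minors E Obs \<subseteq> carrier (moment_ring Obs)"
  proof
    fix p assume "p \<in> observed_trek_minors E Obs"
    then obtain i j c d where p: "p = trek_matrix_minor i j c d" "i \<in> Obs" "j \<in> Obs"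
      "set_trek_column c \<subseteq> Obs" "set_trek_column d \<subseteq> Obs"
      unfolding observed_trek_minors_def by blast
    then have "trek_matrix_entry k e \<in> carrier (moment_ring Obs)" if "k \<in> {i, j}" "e \<in> {c, d}" for k e
      unfolding trek_matrix_entry_eq using that
      by (intro mset_poly_in_moment_ring size_col_mset) (auto simp: set_col_mset)
    then show "p \<in> carrier (moment_ring Obs)"
      unfolding p(1) trek_matrix_minor_def by (intro cpoly_ring_diff cpoly_ring_mult) auto
  qed
  moreover have "observed_trekless_moments E Obs \<subseteq> carrier (moment_ring Obs)"
    unfolding trekless_generators using mset_poly_in_moment_ring by blast
  ultimately show ?thesis by blast
qed

lemma ideal_trek_ideal: "ideal trek_ideal (moment_ring Obs)"
  using ring.genideal_ideal[OF cring.axioms(1)[OF cring_cpoly_ring] trek_generators_in_ring] .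

lemma generator_in_trek_ideal: "p \<in> trek_generators \<Longrightarrow> p \<in> trek_ideal"
  using ring.genideal_self[OF cring.axioms(1)[OF cring_cpoly_ring] trek_generators_in_ring] by blast

text \<open>On the model a trek-matrix has rank at most one: the column \<open>A\<close> is
  \<open>C\<close> times the vector of path weights from the top of \<open>i\<close> and
  \<open>j\<close> to these two vertices, and that vector is the same for all columns.\<close>

lemma diag_moment_factor:
  assumes L: "L \<in> edge_matrices E" and x: "linked (add_mset i A)" "linked (add_mset j A)"
    and t: "top_of (add_mset i A) = top_of (add_mset j A)"
  obtains C where
    "diag_moment W (matrix_inv (mat 1 - L)) (add_mset i A) = C * matrix_inv (mat 1 - L) $ top_of {#i, j#} $ i"
    "diag_moment W (matrix_inv (mat 1 - L)) (add_mset j A) = C * matrix_inv (mat 1 - L) $ top_of {#i, j#} $ j"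
proof -
  let ?M = "matrix_inv (mat 1 - L)"
  define u where "u = top_of (add_mset i A)"
  have u: "u \<preceq> i" "u \<preceq> j" using top_of_reaches[OF x(1), of i] top_of_reaches[OF x(2), of j] t by (auto simp: u_def)
  then have ij: "linked {#i, j#}" by (intro linkedI[of _ u]) auto
  define v where "v = top_of {#i, j#}"
  have v: "u \<preceq> v" "v \<preceq> i" "v \<preceq> j"
    using reaches_top_of[OF ij, of u] u top_of_reaches[OF ij] by (auto simp: v_def)
  \<comment> \<open>The part of the simple trek rule that is common to both rows: the moment of the
    top \<open>u\<close>, the path from \<open>u\<close> to \<open>v\<close>, and the paths to the
    other indices.\<close>
  define C where "C = diag_moment W ?M (replicate_mset (Suc (size A)) u) * ?M $ u $ v * (\<Prod>k\<in>#A. ?M $ u $ k)"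
  have "diag_moment W ?M (add_mset i A) = C * ?M $ v $ i"
    unfolding diag_moment_linked[OF L x(1) u_def[symmetric]] using path_weight_mult[OF L v(1,2)]
    by (simp add: C_def)
  moreover have "diag_moment W ?M (add_mset j A) = C * ?M $ v $ j"
    unfolding diag_moment_linked[OF L x(2) u_def[unfolded t, symmetric]] using path_weight_mult[OF L v(1,3)]
    by (simp add: C_def)
  ultimately show ?thesis using that unfolding v_def by blast
qed

lemma trek_generators_vanish: "trek_generators \<subseteq> observed_ideal E Obs"
proof
  fix p assume p: "p \<in> trek_generators"
  have "eval_cpoly (moment_value S T) p = 0" if ST: "(S, T) \<in> moment_model E" for S T
  proof -
    obtain L W where L: "L \<in> edge_matrices E"
      and D: "\<And>i j. S $ i $ j = diag_moment W (matrix_inv (mat 1 - L)) {#i, j#}"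
        "\<And>i j k. T $ i $ j $ k = diag_moment W (matrix_inv (mat 1 - L)) {#i, j, k#}"
      using moment_model_diag_moment[OF ST] by blast
    note eval = eval_mset_poly[of S "diag_moment W (matrix_inv (mat 1 - L))" T, OF D]
    from p show ?thesis
    proof
      assume "p \<in> observed_trek_minors E Obs"
      then obtain i j c d where p: "p = trek_matrix_minor i j c d"
        "c \<in> trek_matrix_columns E i j" "d \<in> trek_matrix_columns E i j"
        unfolding observed_trek_minors_def by blast
      note c = p(2)[unfolded trek_matrix_columns_iff] and d = p(3)[unfolded trek_matrix_columns_iff]
      obtain C where C:
        "diag_moment W (matrix_inv (mat 1 - L)) (add_mset i (col_mset c)) = C * matrix_inv (mat 1 - L) $ top_of {#i, j#} $ i"
        "diag_moment W (matrix_inv (mat 1 - L)) (add_mset j (col_mset c)) = C * matrix_inv (mat 1 - L) $ top_of {#i, j#} $ j"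
        using c by (blast intro: diag_moment_factor[OF L])
      obtain C' where C':
        "diag_moment W (matrix_inv (mat 1 - L)) (add_mset i (col_mset d)) = C' * matrix_inv (mat 1 - L) $ top_of {#i, j#} $ i"
        "diag_moment W (matrix_inv (mat 1 - L)) (add_mset j (col_mset d)) = C' * matrix_inv (mat 1 - L) $ top_of {#i, j#} $ j"
        using d by (blast intro: diag_moment_factor[OF L])
      show ?thesis
        unfolding p(1) trek_matrix_minor_def trek_matrix_entry_eq eval_cpoly_diff eval_cpoly_mult
          eval[OF size_col_mset] C C' by simp
    next
      assume "p \<in> observed_trekless_moments E Obs"
      then obtain x where x: "p = mset_poly x" "size x \<in> {2, 3}" "\<not> linked x"
        unfolding trekless_generators by blast
      have "x \<noteq> {#}" using x(2) by auto
      then show ?thesis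
        using eval[OF x(2)] diag_moment_not_linked[OF L x(3)] by (simp add: x(1))
    qed
  qed
  then show "p \<in> observed_ideal E Obs"
    using p trek_generators_in_ring by (auto simp: observed_ideal_eq)
qed

lemma swap_minor_in_trek_ideal:
  assumes l: "linked (add_mset i A)" "linked (add_mset j B)" "linked (add_mset j A)" "linked (add_mset i B)"
    and t: "top_of (add_mset j A) = top_of (add_mset i A)" "top_of (add_mset i B) = top_of (add_mset j B)"
    and s: "size (add_mset i A) \<in> {2, 3}" "size (add_mset j B) \<in> {2, 3}"
    and obs: "set_mset (add_mset i A) \<subseteq> Obs" "set_mset (add_mset j B) \<subseteq> Obs"
  shows "mset_poly (add_mset i A) * mset_poly (add_mset j B) -
    mset_poly (add_mset j A) * mset_poly (add_mset i B) \<in> trek_ideal"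
proof -
  have sA: "size A \<in> {1, 2}" and sB: "size B \<in> {1, 2}" using s by auto
  obtain c where c: "col_mset c = A" "\<forall>l m. c = T_col l m \<longrightarrow> l \<le> m" using col_mset_exists[OF sA] by blast
  obtain d where d: "col_mset d = B" "\<forall>l m. d = T_col l m \<longrightarrow> l \<le> m" using col_mset_exists[OF sB] by blast
  have eq: "mset_poly (add_mset i A) * mset_poly (add_mset j B) -
      mset_poly (add_mset j A) * mset_poly (add_mset i B) = trek_matrix_minor i j c d"
    by (simp add: trek_matrix_minor_def trek_matrix_entry_eq c d mult.commute)
  show ?thesis
  \<comment> \<open>Minors with equal columns are not among the generators, but then the difference
    is zero.\<close>
  proof (cases "c = d")
    case True
    then show ?thesis using c d cpoly_ideal_zero[OF ideal_trek_ideal] by (simp add: mult.commute)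
  next
    case False
    have "linked {#i, j#}"
      using top_of_reaches[OF l(1), of i] top_of_reaches[OF l(3), of j] t(1)
      by (intro linkedI[of _ "top_of (add_mset i A)"]) auto
    then have "trek_exists E [i, j]" by (simp add: trek_exists_iff_linked)
    moreover have "c \<in> trek_matrix_columns E i j" "d \<in> trek_matrix_columns E i j"
      using c d l t by (auto simp: trek_matrix_columns_iff)
    moreover have "set_trek_column c \<subseteq> Obs" "set_trek_column d \<subseteq> Obs" "i \<in> Obs" "j \<in> Obs"
      using obs c d by (auto simp: set_col_mset[symmetric])
    ultimately have "trek_matrix_minor i j c d \<in> observed_trek_minors E Obs"
      using False unfolding observed_trek_minors_def by blast
    then show ?thesis unfolding eq using generator_in_trek_ideal by blast
  qed
qed

lemma swap_congruent:
  assumes "swap M N" "observable Obs M"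
  shows "observable Obs N \<and> mset_monomial M - mset_monomial N \<in> trek_ideal"
  using assms
proof (induction rule: swap.induct)
  case (swap i A j B v R)
  have o: "observable Obs R" "size (add_mset i A) \<in> {2, 3}" "size (add_mset j B) \<in> {2, 3}"
    "set_mset (add_mset i A) \<subseteq> Obs" "set_mset (add_mset j B) \<subseteq> Obs"
    using swap.prems by (auto simp: observable_def)
  have "mset_monomial R * (mset_poly (add_mset i A) * mset_poly (add_mset j B) -
      mset_poly (add_mset j A) * mset_poly (add_mset i B)) \<in> trek_ideal"
    using swap_minor_in_trek_ideal[OF swap.hyps(1-6) o(2-5)] mset_monomial_in_moment_ring[OF o(1)]
    by (rule cpoly_ideal_mult[OF ideal_trek_ideal])
  then have "mset_monomial (add_mset (add_mset i A) (add_mset (add_mset j B) R)) -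
      mset_monomial (add_mset (add_mset j A) (add_mset (add_mset i B) R)) \<in> trek_ideal"
    by (simp add: mset_monomial_def algebra_simps)
  then show ?case using swap.prems by (auto simp: observable_def)
qed

lemma swaps_congruent:
  assumes "swap\<^sup>*\<^sup>* M N" "observable Obs M"
  shows "mset_monomial M - mset_monomial N \<in> trek_ideal"
proof -
  have "observable Obs N \<and> mset_monomial M - mset_monomial N \<in> trek_ideal"
    using assms
  proof (induction rule: rtranclp_induct)
    case base
    then show ?case using cpoly_ideal_zero[OF ideal_trek_ideal] by simp
  next
    case (step N K)
    then show ?case
      using swap_congruent[OF step.hyps(2)] cpoly_ideal_add[OF ideal_trek_ideal, of "mset_monomial M - mset_monomial N" "mset_monomial N - mset_monomial K"]
      by simp
  qed
  then show ?thesis by blast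
qed

lemma unlinked_monomial_in_trek_ideal:
  assumes "observable Obs M" "x \<in># M" "\<not> linked x"
  shows "mset_monomial M \<in> trek_ideal"
proof -
  obtain N where N: "M = add_mset x N" using assms(2) by (metis insert_DiffM)
  have "mset_poly x \<in> trek_ideal"
    using assms by (intro generator_in_trek_ideal) (auto simp: trekless_generators observable_def)
  moreover have "observable Obs N" using assms(1) N by (simp add: observable_def)
  ultimately have "mset_monomial N * mset_poly x \<in> trek_ideal"
    by (intro cpoly_ideal_mult[OF ideal_trek_ideal] mset_monomial_in_moment_ring)
  then show ?thesis by (simp add: N mset_monomial_def mult.commute)
qed

text \<open>Monomials with a factor that has no trek lie in the ideal already. Along the curve of
  \<open>realize_weights\<close> they vanish, and every other monomial \<open>m\<close> becomes
  \<open>X ^ w m\<close>, so the coefficients of \<open>p\<close> sum to zero over the monomials of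
  equal weight. Equal weight means equal type, hence congruence by exchanges.\<close>

lemma observed_ideal_subset: "observed_ideal E Obs \<subseteq> trek_ideal"
proof
  fix p assume p: "p \<in> observed_ideal E Obs"
  let ?K = "Poly_Mapping.keys p" and ?c = "Poly_Mapping.lookup p"
  have "\<exists>M. observable Obs M \<and> Poly_Mapping.single m 1 = mset_monomial M" if "m \<in> ?K" for m
    using that p by (intro single_as_mset_monomial) (auto simp: observed_ideal_eq cpoly_ring_def)
  then obtain F where F: "\<And>m. m \<in> ?K \<Longrightarrow> observable Obs (F m)"
    "\<And>m. m \<in> ?K \<Longrightarrow> Poly_Mapping.single m 1 = mset_monomial (F m)" by metis
  define P where "P m = mset_monomial (F m)" for m
  have single: "Poly_Mapping.single m (?c m) = Poly_Mapping.single 0 (?c m) * P m" if "m \<in> ?K" for m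
    unfolding P_def F(2)[OF that, symmetric] by (simp add: mult_single)
  have p_eq: "p = (\<Sum>m\<in>?K. Poly_Mapping.single 0 (?c m) * P m)"
    using sum_singles[of p] single by simp
  define G where "G = {m \<in> ?K. \<forall>x\<in>#F m. linked x}"
  have finG: "finite G" by (simp add: G_def)
  have split: "p = (\<Sum>m\<in>G. Poly_Mapping.single 0 (?c m) * P m) + (\<Sum>m\<in>?K - G. Poly_Mapping.single 0 (?c m) * P m)"
    by (subst p_eq, subst sum.subset_diff[of G]) (auto simp: G_def add.commute)
  have const: "Poly_Mapping.single 0 r \<in> carrier (moment_ring Obs)" for r
    by (rule single_in_cpoly_ring) simp
  have bad: "(\<Sum>m\<in>?K - G. Poly_Mapping.single 0 (?c m) * P m) \<in> trek_ideal"
    unfolding P_def using F(1) const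
    by (intro cpoly_ideal_sum[OF ideal_trek_ideal] cpoly_ideal_mult[OF ideal_trek_ideal])
      (auto simp: G_def intro: unlinked_monomial_in_trek_ideal)
  have good: "linked x \<and> size x \<in> {2, 3}" if "M \<in> F ` G" "x \<in># M" for M x
    using that F(1) by (auto simp: G_def observable_def)
  obtain g k where sep: "\<And>M N. M \<in> F ` G \<Longrightarrow> N \<in> F ` G \<Longrightarrow>
      (\<Sum>x\<in>#M. weight g k x) = (\<Sum>x\<in>#N. weight g k x) \<Longrightarrow> same_type M N"
    and gk: "\<And>t e. t \<in> {2, 3} \<times> UNIV \<Longrightarrow> e \<in> E \<Longrightarrow> 1 \<le> g t \<and> g t \<le> k e"
    using separating_weights[of "F ` G"] finG good by blast
  define w where "w m = (\<Sum>x\<in>#F m. weight g k x)" for m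
  have cong: "P a - P b \<in> trek_ideal" if "a \<in> G" "b \<in> G" "w a = w b" for a b
  proof -
    have "admissible (F m)" if "m \<in> G" for m
      using good that unfolding admissible_def by fastforce
    then have "swap\<^sup>*\<^sup>* (F a) (F b)"
      using that sep by (intro same_type_imp_swaps) (auto simp: w_def)
    then show ?thesis unfolding P_def using F(1) that by (intro swaps_congruent) (auto simp: G_def)
  qed
  \<comment> \<open>With n vertices, a positive parameter below 1/(n+1) satisfies both bounds of
    \<open>realize_weights\<close>, being below 1 and having a product with n below 1.\<close>
  let ?Z = "complex_of_real ` {0<..<1 / real (Suc CARD('v))}"
  have "infinite {0<..<1 / real (Suc CARD('v))}" by (intro infinite_Ioo) simp
  then have inf: "infinite ?Z" by (simp add: finite_image_iff inj_on_def)
  have zeros: "(\<Sum>m\<in>G. ?c m * X ^ w m) = 0" if "X \<in> ?Z" for X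
  proof -
    from that obtain r where Xr: "X = complex_of_real r" "r \<in> {0<..<1 / real (Suc CARD('v))}"
      by (rule imageE)
    then have r: "0 < r" "r < 1 / real (Suc CARD('v))"
      unfolding greaterThanLessThan_iff by blast+
    have "r * real (Suc CARD('v)) < 1" using r by (simp add: field_simps)
    then have "r + real CARD('v) * r < 1" by (simp add: algebra_simps)
    moreover have "0 \<le> real CARD('v) * r" using r(1) by (intro mult_nonneg_nonneg) auto
    ultimately have r': "real CARD('v) * r < 1" "r < 1" using r(1) by linarith+
    obtain S T D where ST: "(S, T) \<in> moment_model E"
      "\<And>i j. S $ i $ j = D {#i, j#}" "\<And>i j l. T $ i $ j $ l = D {#i, j, l#}"
      and D: "\<And>x. size x \<in> {2, 3} \<Longrightarrow> D x = (if linked x then r ^ weight g k x else 0)"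
    proof (rule realize_weights[of g k r, OF _ r(1) r'(2,1)])
      show "1 \<le> g t \<and> g t \<le> k e" if "t \<in> {2, 3} \<times> UNIV" "e \<in> E" for t e
        using gk[OF that] .
    next
      fix S T D
      assume "(S, T) \<in> moment_model E" "\<And>i j. S $ i $ j = D {#i, j#}"
        "\<And>i j l. T $ i $ j $ l = D {#i, j, l#}"
        "\<And>x. size x \<in> {2, 3} \<Longrightarrow> D x = (if linked x then r ^ weight g k x else 0)"
      then show thesis by (rule that)
    qed
    note eval = eval_mset_poly[of S D T, OF ST(2,3)]
    have e: "eval_cpoly (moment_value S T) (P m) = (\<Prod>x\<in>#F m. complex_of_real (D x))" if "m \<in> ?K" for m
      unfolding P_def mset_monomial_def eval_cpoly_prod_mset using F(1)[OF that] eval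
      by (intro arg_cong[of _ _ prod_mset] image_mset_cong) (auto simp: observable_def)
    have eG: "eval_cpoly (moment_value S T) (P m) = X ^ w m" if "m \<in> G" for m
    proof -
      have *: "(\<Prod>x\<in>#M. complex_of_real (D x)) = X ^ (\<Sum>x\<in>#M. weight g k x)"
        if "\<forall>x\<in>#M. linked x \<and> size x \<in> {2, 3}" for M
        using that
      proof (induction M)
        case (add x M)
        then have "D x = r ^ weight g k x" using D[of x] by simp
        then show ?case using add by (simp add: Xr(1) power_add)
      qed simp
      have "m \<in> ?K" "\<forall>x\<in>#F m. linked x \<and> size x \<in> {2, 3}"
        using that good[of "F m"] by (auto simp only: G_def)
      then show ?thesis unfolding w_def by (simp only: e *)
    qed
    have e0: "eval_cpoly (moment_value S T) (P m) = 0" if "m \<in> ?K - G" for m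
    proof -
      from that obtain x where x: "x \<in># F m" "\<not> linked x" and m: "m \<in> ?K" unfolding G_def by blast
      then have "size x \<in> {2, 3}" using F(1)[OF m] unfolding observable_def by blast
      then have "D x = 0" using D x(2) by simp
      then have "(\<Prod>x\<in>#F m. complex_of_real (D x)) = 0"
        using x(1) by (auto simp: prod_mset_zero_iff intro!: image_eqI[of _ _ x])
      then show ?thesis unfolding e[OF m] .
    qed
    have const': "eval_cpoly (moment_value S T) (Poly_Mapping.single 0 a) = a" for a
      by (simp add: eval_mono_def)
    have "eval_cpoly (moment_value S T) p = 0"
      using p ST(1) unfolding observed_ideal_eq by blast
    moreover have "eval_cpoly (moment_value S T) p =
        (\<Sum>m\<in>G. ?c m * eval_cpoly (moment_value S T) (P m)) +
        (\<Sum>m\<in>?K - G. ?c m * eval_cpoly (moment_value S T) (P m))"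
      by (subst split) (simp only: eval_cpoly_add eval_cpoly_sum eval_cpoly_mult const')
    moreover have "(\<Sum>m\<in>?K - G. ?c m * eval_cpoly (moment_value S T) (P m)) = 0"
      by (intro sum.neutral ballI) (simp only: e0 mult_zero_right)
    moreover have "(\<Sum>m\<in>G. ?c m * eval_cpoly (moment_value S T) (P m)) = (\<Sum>m\<in>G. ?c m * X ^ w m)"
      by (rule sum.cong) (simp_all only: eG)
    ultimately show ?thesis by simp
  qed
  have coeffs: "(\<Sum>m\<in>{m \<in> G. w m = n}. ?c m) = 0" for n
    by (rule zero_of_infinitely_many_zeros[OF finG inf zeros])
  have "(\<Sum>m\<in>G. Poly_Mapping.single 0 (?c m) * P m) \<in> trek_ideal"
    by (rule cpoly_ideal_sum_classes[OF ideal_trek_ideal finG cong coeffs])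
  from cpoly_ideal_add[OF ideal_trek_ideal this bad] show "p \<in> trek_ideal"
    by (simp only: split[symmetric])
qed

lemma trek_ideal_subset: "trek_ideal \<subseteq> observed_ideal E Obs"
  using ring.genideal_minimal[OF cring.axioms(1)[OF cring_cpoly_ring] ideal_observed_ideal trek_generators_vanish] .

end

theorem proposition5p4:
  fixes E :: "'v::{finite,linorder} rel" and Hid Obs :: "'v set"
  assumes "polytree E"
    and "upstream_partition E Hid Obs"
  shows "observed_ideal E Obs =
    Idl\<^bsub>moment_ring Obs\<^esub> (observed_trek_minors E Obs \<union> observed_trekless_moments E Obs)"
proof -
  interpret ordered_polytree E Obs by unfold_locales (rule assms(1))
  show ?thesis by (intro subset_antisym observed_ideal_subset trek_ideal_subset)
qed

end
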